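(* There exist a self-adjoint, positive, unbounded operator $\Gamma$ with a discrete spectrum on a separable Hilbert space $H$ and a self-adjoint operator $L$ on $H$ such that the following conditions are satisfied: (i) $\|L\phi\|\le C\|\phi\|_1$ and $\|e^{iLt}\phi\|_1\le B(t)\|\phi\|_1$ for some $C<\infty$, some $B(t)\in L^1_{\rm loc}[0,\infty)$, and any $\phi\in H^1(\Gamma)$ (and all $t>0$); (ii) $L$ has eigenvectors, but not a single one belongs to $H^s(\Gamma)$ for any $s>0$.
   Context: $\|\cdot\|$ is the norm of $H$. Discrete spectrum: $\Gamma$ has eigenvalues $0<\lambda_1\le\lambda_2\le\dots$, $\lambda_n\to\infty$, with orthonormal eigenvectors $e_j$ forming a basis of $H$. For $s\ge0$, $H^s(\Gamma)$ is the space of $\psi=\sum_jc_je_j$ with $\|\psi\|_s^2=\sum_j\lambda_j^s|c_j|^2<\infty$. $e^{iLt}$ is the unitary group generated by $L$. $C$ and $B$ are independent of $\phi$. *)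

theory Defs
  imports
    "HOL-Analysis.Analysis"
    "HOL-Algebra.Module"
    "HOL-Algebra.Algebraic_Closure_Type"
begin

section \<open>Complex Hilbert spaces\<close>

text \<open>
  Hilbert spaces are objects here (a carrier with operations), so that a statement can quantify
  over them. The vector-space part is a HOL-Algebra module over the field of complex numbers; the
  fields for multiplication and unit that a module record inherits play no role.
\<close>

abbreviation complex_ring :: "complex ring" where
  "complex_ring \<equiv> ring_of_type_algebra"

record 'a cinner_space = "(complex, 'a) module" +
  cinner :: "'a \<Rightarrow> 'a \<Rightarrow> complex"

definition hnorm :: "('a, 'b) cinner_space_scheme \<Rightarrow> 'a \<Rightarrow> real" where
  "hnorm H x = sqrt (Re (cinner H x x))"

text \<open>
  The locale \<open>Metric_space\<close> requires symmetry and nonnegativity of the distance also outside of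
  the carrier, hence the default value.
\<close>

definition hdist :: "('a, 'b) cinner_space_scheme \<Rightarrow> 'a \<Rightarrow> 'a \<Rightarrow> real" where
  "hdist H x y = (if x \<in> carrier H \<and> y \<in> carrier H then hnorm H (x \<ominus>\<^bsub>H\<^esub> y) else 0)"

abbreviation htopology :: "('a, 'b) cinner_space_scheme \<Rightarrow> 'a topology" where
  "htopology H \<equiv> Metric_space.mtopology (carrier H) (hdist H)"

locale complex_inner_space = module complex_ring H
  for H :: "('a, 'b) cinner_space_scheme" (structure) +
  assumes cinner_add_left:
      "\<lbrakk>x \<in> carrier H; y \<in> carrier H; z \<in> carrier H\<rbrakk> \<Longrightarrow>
        cinner H (x \<oplus> y) z = cinner H x z + cinner H y z"
    and cinner_smult_left:
      "\<lbrakk>x \<in> carrier H; y \<in> carrier H\<rbrakk> \<Longrightarrow> cinner H (a \<odot> x) y = a * cinner H x y"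
    and cinner_commute:
      "\<lbrakk>x \<in> carrier H; y \<in> carrier H\<rbrakk> \<Longrightarrow> cinner H x y = cnj (cinner H y x)"
    and cinner_nonneg: "x \<in> carrier H \<Longrightarrow> 0 \<le> Re (cinner H x x)"
    and cinner_definite: "\<lbrakk>x \<in> carrier H; cinner H x x = 0\<rbrakk> \<Longrightarrow> x = \<zero>"
begin

lemma complex_ring_simps [simp]:
  "carrier complex_ring = UNIV" "add complex_ring = (+)" "monoid.mult complex_ring = (*)"
  "one complex_ring = 1" "ring.zero complex_ring = 0"
  by (simp_all add: ring_of_type_algebra_def)

lemma cinner_zero_left: "y \<in> carrier H \<Longrightarrow> cinner H \<zero> y = 0"
  using cinner_smult_left[of \<zero> y 0] by simp

lemma cinner_add_right:
  "\<lbrakk>x \<in> carrier H; y \<in> carrier H; z \<in> carrier H\<rbrakk> \<Longrightarrow>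
    cinner H x (y \<oplus> z) = cinner H x y + cinner H x z"
  by (metis M.a_closed cinner_add_left cinner_commute complex_cnj_add)

lemma cinner_smult_right:
  "\<lbrakk>x \<in> carrier H; y \<in> carrier H\<rbrakk> \<Longrightarrow> cinner H x (a \<odot> y) = cnj a * cinner H x y"
  by (metis UNIV_I cinner_commute cinner_smult_left complex_cnj_mult complex_ring_simps(1)
      smult_closed)

lemma Re_cinner_commute:
  "\<lbrakk>x \<in> carrier H; y \<in> carrier H\<rbrakk> \<Longrightarrow> Re (cinner H x y) = Re (cinner H y x)"
  by (metis cinner_commute complex_cnj(1) complex.collapse complex.sel(1))

lemma Im_cinner_self: "x \<in> carrier H \<Longrightarrow> Im (cinner H x x) = 0"
  using cinner_commute[of x x] by (simp add: complex_eq_iff)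

lemma hnorm_nonneg: "x \<in> carrier H \<Longrightarrow> 0 \<le> hnorm H x"
  by (simp add: hnorm_def cinner_nonneg)

lemma hnorm_power2: "x \<in> carrier H \<Longrightarrow> (hnorm H x)\<^sup>2 = Re (cinner H x x)"
  by (simp add: hnorm_def cinner_nonneg)

lemma hnorm_eq_0: "x \<in> carrier H \<Longrightarrow> hnorm H x = 0 \<longleftrightarrow> x = \<zero>"
  using cinner_definite[of x] Im_cinner_self[of x] cinner_zero_left[of \<zero>]
  by (auto simp: hnorm_def complex_eq_iff)

lemma uminus_eq_smult: "x \<in> carrier H \<Longrightarrow> \<ominus> x = (-1) \<odot> x"
proof -
  assume x: "x \<in> carrier H"
  have "(-1 + 1) \<odot> x = (-1) \<odot> x \<oplus> 1 \<odot> x"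
    using smult_l_distr[of "-1" 1 x] x by simp
  then have "(-1) \<odot> x \<oplus> x = \<zero>"
    using smult_one[of x] smult_l_null[of x] x by simp
  then show ?thesis
    using M.minus_equality[of "(-1) \<odot> x" x] x smult_closed[of "-1" x] by simp
qed

lemma Re_cinner_le:
  assumes x: "x \<in> carrier H" and y: "y \<in> carrier H"
  shows "Re (cinner H x y) \<le> hnorm H x * hnorm H y"
proof (cases "y = \<zero>")
  case True
  then show ?thesis
    using cinner_zero_left[OF x] Re_cinner_commute[OF x y] hnorm_nonneg[OF x] hnorm_nonneg[OF y]
    by simp
next
  case False
  define b where "b = Re (cinner H x y)"
  have c: "0 < (hnorm H y)\<^sup>2"
    using hnorm_eq_0[OF y] False by simp
  define t where "t = - (b / (hnorm H y)\<^sup>2)"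
  have ty: "complex_of_real t \<odot> y \<in> carrier H"
    using y smult_closed by simp
  have "0 \<le> Re (cinner H (x \<oplus> complex_of_real t \<odot> y) (x \<oplus> complex_of_real t \<odot> y))"
    using x ty by (intro cinner_nonneg) simp
  also have "\<dots> = (hnorm H x)\<^sup>2 + 2 * t * b + t\<^sup>2 * (hnorm H y)\<^sup>2"
    using x y ty Re_cinner_commute[OF x y]
    by (simp add: cinner_add_left cinner_add_right cinner_smult_left cinner_smult_right
        hnorm_power2[unfolded power2_eq_square] b_def power2_eq_square algebra_simps)
  also have "\<dots> = (hnorm H x)\<^sup>2 - b\<^sup>2 / (hnorm H y)\<^sup>2"
    using c by (simp add: t_def power2_eq_square field_simps)
  finally have "b\<^sup>2 \<le> (hnorm H x * hnorm H y)\<^sup>2"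
    using c by (simp add: field_simps power_mult_distrib)
  then show ?thesis
    using hnorm_nonneg[OF x] hnorm_nonneg[OF y] unfolding b_def
    by (meson mult_nonneg_nonneg power2_le_imp_le)
qed

lemma hnorm_triangle:
  assumes x: "x \<in> carrier H" and y: "y \<in> carrier H"
  shows "hnorm H (x \<oplus> y) \<le> hnorm H x + hnorm H y"
proof (rule power2_le_imp_le)
  have "(hnorm H (x \<oplus> y))\<^sup>2 = (hnorm H x)\<^sup>2 + 2 * Re (cinner H x y) + (hnorm H y)\<^sup>2"
    using x y Re_cinner_commute[OF x y]
    by (simp add: cinner_add_left cinner_add_right hnorm_power2)
  also have "\<dots> \<le> (hnorm H x + hnorm H y)\<^sup>2"
    using Re_cinner_le[OF x y] by (simp add: power2_sum)
  finally show "(hnorm H (x \<oplus> y))\<^sup>2 \<le> (hnorm H x + hnorm H y)\<^sup>2" .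
qed (use hnorm_nonneg[OF x] hnorm_nonneg[OF y] in simp)

lemma hnorm_minus_commute:
  assumes x: "x \<in> carrier H" and y: "y \<in> carrier H"
  shows "hnorm H (x \<ominus> y) = hnorm H (y \<ominus> x)"
proof -
  have "x \<ominus> y = \<ominus> (y \<ominus> x)"
    using x y by (simp add: M.minus_eq M.minus_add M.a_comm)
  then have "x \<ominus> y = (-1) \<odot> (y \<ominus> x)"
    using x y by (simp add: uminus_eq_smult)
  then show ?thesis
    using x y smult_closed[of "-1" "y \<ominus> x"]
    by (simp add: hnorm_def cinner_smult_left cinner_smult_right)
qed

sublocale Metric_space "carrier H" "hdist H"
proof
  fix x y z
  show "0 \<le> hdist H x y"
    by (simp add: hdist_def hnorm_nonneg)
  show "hdist H x y = hdist H y x"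
    by (simp add: hdist_def hnorm_minus_commute)
  show "hdist H x y = 0 \<longleftrightarrow> x = y" if "x \<in> carrier H" "y \<in> carrier H"
    using that M.minus_equality[of x "\<ominus> y"]
    by (auto simp: hdist_def hnorm_eq_0 M.minus_eq M.r_neg)
  show "hdist H x z \<le> hdist H x y + hdist H y z"
    if "x \<in> carrier H" "y \<in> carrier H" "z \<in> carrier H"
  proof -
    have "x \<ominus> z = (x \<ominus> y) \<oplus> (y \<ominus> z)"
      using that by (simp add: M.minus_eq M.a_assoc M.r_neg1)
    then show ?thesis
      using that hnorm_triangle[of "x \<ominus> y" "y \<ominus> z"] by (simp add: hdist_def)
  qed
qed

end

locale separable_hilbert_space = complex_inner_space +
  assumes complete: "Metric_space.mcomplete (carrier H) (hdist H)"
    and separable: "separable_space (htopology H)"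

definition orthonormal_basis ::
    "('a, 'b) cinner_space_scheme \<Rightarrow> (nat \<Rightarrow> 'a) \<Rightarrow> bool" where
  "orthonormal_basis H e \<longleftrightarrow>
    (\<forall>n. e n \<in> carrier H) \<and>
    (\<forall>m n. cinner H (e m) (e n) = (if m = n then 1 else 0)) \<and>
    (\<forall>x \<in> carrier H.
      limitin (htopology H) (\<lambda>n. \<Oplus>\<^bsub>H\<^esub>j\<in>{..<n}. cinner H x (e j) \<odot>\<^bsub>H\<^esub> e j) x sequentially)"


section \<open>Unbounded operators\<close>

text \<open>The values of \<open>op_app A\<close> outside of \<open>op_dom A\<close> are irrelevant.\<close>

record 'a operator =
  op_dom :: "'a set"
  op_app :: "'a \<Rightarrow> 'a"

definition linear_operator ::
    "('a, 'b) cinner_space_scheme \<Rightarrow> 'a operator \<Rightarrow> bool" where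
  "linear_operator H A \<longleftrightarrow>
    submodule (op_dom A) complex_ring H \<and>
    op_app A \<in> op_dom A \<rightarrow> carrier H \<and>
    (\<forall>x \<in> op_dom A. \<forall>y \<in> op_dom A. op_app A (x \<oplus>\<^bsub>H\<^esub> y) = op_app A x \<oplus>\<^bsub>H\<^esub> op_app A y) \<and>
    (\<forall>a. \<forall>x \<in> op_dom A. op_app A (a \<odot>\<^bsub>H\<^esub> x) = a \<odot>\<^bsub>H\<^esub> op_app A x)"

definition densely_defined ::
    "('a, 'b) cinner_space_scheme \<Rightarrow> 'a operator \<Rightarrow> bool" where
  "densely_defined H A \<longleftrightarrow> htopology H closure_of op_dom A = carrier H"

definition op_graph :: "'a operator \<Rightarrow> ('a \<times> 'a) set" where
  "op_graph A = {(x, op_app A x) | x. x \<in> op_dom A}"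

definition adjoint_graph ::
    "('a, 'b) cinner_space_scheme \<Rightarrow> 'a operator \<Rightarrow> ('a \<times> 'a) set" where
  "adjoint_graph H A = {(y, z). y \<in> carrier H \<and> z \<in> carrier H \<and>
    (\<forall>x \<in> op_dom A. cinner H (op_app A x) y = cinner H x z)}"

definition self_adjoint ::
    "('a, 'b) cinner_space_scheme \<Rightarrow> 'a operator \<Rightarrow> bool" where
  "self_adjoint H A \<longleftrightarrow>
    linear_operator H A \<and> densely_defined H A \<and> adjoint_graph H A = op_graph A"

text \<open>Used for self-adjoint operators only, whose quadratic form is real.\<close>

definition positive_operator ::
    "('a, 'b) cinner_space_scheme \<Rightarrow> 'a operator \<Rightarrow> bool" where
  "positive_operator H A \<longleftrightarrow>
    (\<forall>x \<in> op_dom A. x \<noteq> \<zero>\<^bsub>H\<^esub> \<longrightarrow> 0 < Re (cinner H (op_app A x) x))"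

definition unbounded_operator ::
    "('a, 'b) cinner_space_scheme \<Rightarrow> 'a operator \<Rightarrow> bool" where
  "unbounded_operator H A \<longleftrightarrow>
    \<not> (\<exists>K. \<forall>x \<in> op_dom A. hnorm H (op_app A x) \<le> K * hnorm H x)"

definition eigenvectors ::
    "('a, 'b) cinner_space_scheme \<Rightarrow> 'a operator \<Rightarrow> 'a set" where
  "eigenvectors H A =
    {x \<in> op_dom A. x \<noteq> \<zero>\<^bsub>H\<^esub> \<and> (\<exists>\<mu>. op_app A x = \<mu> \<odot>\<^bsub>H\<^esub> x)}"

text \<open>
  The eigenvalues are enumerated from index 0, repeated according to multiplicity; \<open>e\<close> is a
  corresponding orthonormal eigenbasis.
\<close>

definition discrete_spectrum ::
    "('a, 'b) cinner_space_scheme \<Rightarrow> 'a operator \<Rightarrow> (nat \<Rightarrow> real) \<Rightarrow> (nat \<Rightarrow> 'a) \<Rightarrow> bool" where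
  "discrete_spectrum H A lam e \<longleftrightarrow>
    0 < lam 0 \<and> incseq lam \<and> filterlim lam at_top sequentially \<and>
    orthonormal_basis H e \<and>
    (\<forall>n. e n \<in> op_dom A \<and> op_app A (e n) = complex_of_real (lam n) \<odot>\<^bsub>H\<^esub> e n)"


section \<open>The scale of Sobolev spaces of an operator with discrete spectrum\<close>

text \<open>The coefficient of \<open>x\<close> with respect to \<open>e j\<close> is \<open>cinner H x (e j)\<close>.\<close>

definition sobolev_space ::
    "('a, 'b) cinner_space_scheme \<Rightarrow> (nat \<Rightarrow> real) \<Rightarrow> (nat \<Rightarrow> 'a) \<Rightarrow> real \<Rightarrow> 'a set" where
  "sobolev_space H lam e s =
    {x \<in> carrier H. summable (\<lambda>j. lam j powr s * (cmod (cinner H x (e j)))\<^sup>2)}"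

definition sobolev_norm ::
    "('a, 'b) cinner_space_scheme \<Rightarrow> (nat \<Rightarrow> real) \<Rightarrow> (nat \<Rightarrow> 'a) \<Rightarrow> real \<Rightarrow> 'a \<Rightarrow> real" where
  "sobolev_norm H lam e s x = sqrt (\<Sum>j. lam j powr s * (cmod (cinner H x (e j)))\<^sup>2)"


section \<open>Unitary groups\<close>

definition unitary_on :: "('a, 'b) cinner_space_scheme \<Rightarrow> ('a \<Rightarrow> 'a) \<Rightarrow> bool" where
  "unitary_on H V \<longleftrightarrow>
    linear_operator H \<lparr>op_dom = carrier H, op_app = V\<rparr> \<and>
    bij_betw V (carrier H) (carrier H) \<and>
    (\<forall>x \<in> carrier H. \<forall>y \<in> carrier H. cinner H (V x) (V y) = cinner H x y)"

definition unitary_group ::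
    "('a, 'b) cinner_space_scheme \<Rightarrow> (real \<Rightarrow> 'a \<Rightarrow> 'a) \<Rightarrow> bool" where
  "unitary_group H U \<longleftrightarrow>
    (\<forall>t. unitary_on H (U t)) \<and>
    (\<forall>x \<in> carrier H. U 0 x = x) \<and>
    (\<forall>s t. \<forall>x \<in> carrier H. U (s + t) x = U s (U t x)) \<and>
    (\<forall>x \<in> carrier H. continuous_map euclideanreal (htopology H) (\<lambda>t. U t x))"

text \<open>
  \<open>U t\<close> is the operator exponential of \<open>i L t\<close>: the derivative at 0 of the orbit of \<open>x\<close> under \<open>U\<close>
  exists if and only if \<open>x\<close> is in the domain of \<open>L\<close>, and it is then \<open>i L x\<close>. For self-adjoint \<open>L\<close>
  there is exactly one such \<open>U\<close> on the carrier (Stone's theorem).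
\<close>

definition unitary_group_generated_by ::
    "('a, 'b) cinner_space_scheme \<Rightarrow> 'a operator \<Rightarrow> (real \<Rightarrow> 'a \<Rightarrow> 'a) \<Rightarrow> bool" where
  "unitary_group_generated_by H L U \<longleftrightarrow>
    unitary_group H U \<and>
    (\<forall>x \<in> carrier H. \<forall>y \<in> carrier H.
      limitin (htopology H) (\<lambda>t. complex_of_real (1 / t) \<odot>\<^bsub>H\<^esub> (U t x \<ominus>\<^bsub>H\<^esub> x)) y (at 0) \<longleftrightarrow>
      x \<in> op_dom L \<and> y = \<i> \<odot>\<^bsub>H\<^esub> op_app L x)"

end

theory Submission
  imports Defs "HOL-Real_Asymp.Real_Asymp"
begin

text \<open>
  On \<open>H = \<ell>\<^sup>2\<close> let \<open>\<Gamma>\<close> be multiplication by \<open>4\<^sup>n\<close> and \<open>L = A A*\<close>, where \<open>A\<close> is the bounded lower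
  bidiagonal operator \<open>(A x)\<^sub>n = a\<^sub>n x\<^sub>n - b\<^sub>n\<^sub>-\<^sub>1 x\<^sub>n\<^sub>-\<^sub>1\<close> whose coefficients make \<open>A* A\<close> the free discrete
  Laplacian \<open>2 x\<^sub>n - x\<^sub>n\<^sub>-\<^sub>1 - x\<^sub>n\<^sub>+\<^sub>1\<close> on the half-line. The latter has no square-summable eigenvector, since
  \<open>x\<^sub>n\<^sup>2 - \<kappa> x\<^sub>n x\<^sub>n\<^sub>+\<^sub>1 + x\<^sub>n\<^sub>+\<^sub>1\<^sup>2\<close> is constant along solutions of \<open>x\<^sub>n\<^sub>+\<^sub>2 = \<kappa> x\<^sub>n\<^sub>+\<^sub>1 - x\<^sub>n\<close>. If \<open>v\<close> is an eigenvector
  of \<open>L\<close>, then \<open>A* v\<close> satisfies the eigenvalue equation of \<open>A* A\<close>, hence \<open>A* v = 0\<close>; this determines \<open>v\<close> up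
  to a factor as \<open>v\<^sub>n = ((n + 1) (n + 2))\<^sup>-\<^sup>1\<^sup>/\<^sup>2\<close>, which is square-summable, but decays too slowly for every
  \<open>H\<^sup>s\<close> with \<open>s > 0\<close>.

  Because \<open>L\<close> is tridiagonal with bounded entries, conjugation with \<open>2\<^sup>n\<close> turns it into another bounded
  operator on \<open>\<ell>\<^sup>2\<close>. Hence \<open>L\<close> is bounded on \<open>H\<^sup>1\<close> as well, and \<open>e\<^sup>i\<^sup>L\<^sup>t\<close> grows at most exponentially there.
\<close>

section \<open>The Banach algebra of bounded operators\<close>

text \<open>A copy of \<open>blinfun\<close> for endomorphisms: with a single type argument it can
  be made an instance of the Banach algebra classes, which provide \<open>exp\<close>.\<close>

typedef (overloaded) 'a blinop = "UNIV :: ('a::real_normed_vector \<Rightarrow>\<^sub>L 'a) set"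
  morphisms blinfun_of_blinop Blinop_of_blinfun ..

setup_lifting type_definition_blinop

definition blinop_apply :: "'a::real_normed_vector blinop \<Rightarrow> 'a \<Rightarrow> 'a" where
  "blinop_apply A = blinfun_apply (blinfun_of_blinop A)"

definition Blinop :: "('a::real_normed_vector \<Rightarrow> 'a) \<Rightarrow> 'a blinop" where
  "Blinop f = Blinop_of_blinfun (Blinfun f)"

lemma blinop_apply_Blinop: "bounded_linear f \<Longrightarrow> blinop_apply (Blinop f) = f"
  by (simp add: blinop_apply_def Blinop_def Blinop_of_blinfun_inverse bounded_linear_Blinfun_apply)

lemma blinop_eqI: "(\<And>x. blinop_apply A x = blinop_apply B x) \<Longrightarrow> A = B"
  by (metis blinfun_eqI blinfun_of_blinop_inject blinop_apply_def)

instantiation blinop :: (real_normed_vector) real_normed_vector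
begin

lift_definition norm_blinop :: "'a blinop \<Rightarrow> real" is norm .
lift_definition minus_blinop :: "'a blinop \<Rightarrow> 'a blinop \<Rightarrow> 'a blinop" is minus .
lift_definition uminus_blinop :: "'a blinop \<Rightarrow> 'a blinop" is uminus .
lift_definition zero_blinop :: "'a blinop" is 0 .
lift_definition plus_blinop :: "'a blinop \<Rightarrow> 'a blinop \<Rightarrow> 'a blinop" is plus .
lift_definition scaleR_blinop :: "real \<Rightarrow> 'a blinop \<Rightarrow> 'a blinop" is scaleR .

definition dist_blinop :: "'a blinop \<Rightarrow> 'a blinop \<Rightarrow> real" where
  "dist_blinop A B = norm (A - B)"
definition sgn_blinop :: "'a blinop \<Rightarrow> 'a blinop" where
  "sgn_blinop A = scaleR (inverse (norm A)) A"
definition uniformity_blinop :: "('a blinop \<times> 'a blinop) filter" where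
  "uniformity_blinop = (INF e\<in>{0<..}. principal {(A, B). dist A B < e})"
definition open_blinop :: "'a blinop set \<Rightarrow> bool" where
  "open_blinop S = (\<forall>A\<in>S. \<forall>\<^sub>F (A', B) in uniformity. A' = A \<longrightarrow> B \<in> S)"

instance
  apply standard
  unfolding dist_blinop_def open_blinop_def sgn_blinop_def uniformity_blinop_def
  by (rule refl | (transfer, simp add: algebra_simps norm_triangle_ineq))+

end

text \<open>The representation map is an isometric bijection onto the complete space of
  \<open>blinfun\<close>.\<close>

instance blinop :: (banach) banach
proof
  fix f :: "nat \<Rightarrow> 'a blinop"
  have isom: "dist (blinfun_of_blinop A) (blinfun_of_blinop B) = dist A B" for A B :: "'a blinop"
    unfolding dist_norm by transfer simp
  assume "Cauchy f"
  then have "Cauchy (\<lambda>n. blinfun_of_blinop (f n))"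
    by (simp add: Cauchy_def isom)
  then obtain B where "(\<lambda>n. blinfun_of_blinop (f n)) \<longlonglongrightarrow> B"
    using Cauchy_convergent_iff convergent_def by blast
  then have "f \<longlonglongrightarrow> Blinop_of_blinfun B"
    unfolding tendsto_iff isom[symmetric] by (simp add: Blinop_of_blinfun_inverse)
  then show "convergent f"
    by (rule convergentI)
qed

text \<open>A \<open>perfect_space\<close> is not the zero space, which is what
  \<open>0 \<noteq> 1\<close> and norm 1 of the identity require.\<close>

instantiation blinop :: ("{real_normed_vector, perfect_space}") real_normed_algebra_1
begin

lift_definition times_blinop :: "'a blinop \<Rightarrow> 'a blinop \<Rightarrow> 'a blinop" is blinfun_compose .
lift_definition one_blinop :: "'a blinop" is id_blinfun .

instance
proof
  fix A B C :: "'a blinop" and a :: real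
  show "A * B * C = A * (B * C)"
    by transfer (rule blinfun_eqI, simp)
  show "(A + B) * C = A * C + B * C" "A * (B + C) = A * B + A * C"
    "a *\<^sub>R A * B = a *\<^sub>R (A * B)" "A * a *\<^sub>R B = a *\<^sub>R (A * B)"
    by (transfer; rule blinfun_eqI; simp add: blinfun.bilinear_simps)+
  show "1 * A = A" "A * 1 = A"
    by (transfer; rule blinfun_eqI; simp)+
  show "norm (1 :: 'a blinop) = 1"
    by transfer simp
  then show "(0 :: 'a blinop) \<noteq> 1"
    by (metis norm_zero zero_neq_one)
  show "norm (A * B) \<le> norm A * norm B"
    by transfer (rule norm_blinfun_compose)
qed

end

lemma bounded_linear_blinop_apply: "bounded_linear (blinop_apply A)"
  by (simp add: blinop_apply_def bounded_linear_blinfun_apply bounded_linear_ident)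

lemma blinop_apply_times [simp]: "blinop_apply (A * B) x = blinop_apply A (blinop_apply B x)"
  unfolding blinop_apply_def by transfer simp

lemma blinop_apply_one [simp]: "blinop_apply 1 x = x"
  unfolding blinop_apply_def by transfer simp

lemma norm_blinop_apply: "norm (blinop_apply A x) \<le> norm A * norm x"
  unfolding blinop_apply_def by transfer (rule norm_blinfun)

lemma bounded_linear_blinop_apply_left: "bounded_linear (\<lambda>A. blinop_apply A x)"
proof (rule bounded_linear_intro)
  show "blinop_apply (A + B) x = blinop_apply A x + blinop_apply B x" for A B
    unfolding blinop_apply_def by transfer (simp add: blinfun.bilinear_simps)
  show "blinop_apply (r *\<^sub>R A) x = r *\<^sub>R blinop_apply A x" for r A
    unfolding blinop_apply_def by transfer (simp add: blinfun.bilinear_simps)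
qed (rule norm_blinop_apply)

text \<open>Induction moves \<open>K\<close> past every power, and multiplication by
  \<open>K\<close> is continuous, so it passes through the exponential series. A relation between
  generators thus carries over to the groups.\<close>

lemma exp_intertwine:
  fixes K A B :: "'a::{real_normed_algebra_1, banach}"
  assumes "K * A = B * K"
  shows "K * exp A = exp B * K"
proof -
  have pow: "K * A ^ n = B ^ n * K" for n
  proof (induction n)
    case (Suc n)
    have "K * A ^ Suc n = (K * A) * A ^ n" by (simp add: mult.assoc)
    also have "\<dots> = B * (B ^ n * K)" using Suc by (simp add: assms mult.assoc)
    finally show ?case by (simp add: mult.assoc)
  qed simp
  have "K * exp A = (\<Sum>n. K * (A ^ n /\<^sub>R fact n))"
    unfolding exp_def by (rule suminf_mult[symmetric]) (rule summable_exp_generic)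
  also have "\<dots> = (\<Sum>n. (B ^ n /\<^sub>R fact n) * K)"
    by (simp add: pow)
  also have "\<dots> = exp B * K"
    unfolding exp_def by (rule suminf_mult2[symmetric]) (rule summable_exp_generic)
  finally show ?thesis .
qed

section \<open>One-parameter groups of bounded operators\<close>

definition op_exp :: "'a::{banach, perfect_space} blinop \<Rightarrow> real \<Rightarrow> 'a \<Rightarrow> 'a" where
  "op_exp A t = blinop_apply (exp (t *\<^sub>R A))"

lemma bounded_linear_op_exp: "bounded_linear (op_exp A t)"
  by (simp add: op_exp_def bounded_linear_blinop_apply)

lemma op_exp_0 [simp]: "op_exp A 0 x = x"
  by (simp add: op_exp_def)

lemma op_exp_add: "op_exp A (s + t) x = op_exp A s (op_exp A t x)"
  using exp_add_commuting[of "s *\<^sub>R A" "t *\<^sub>R A"]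
  by (simp add: op_exp_def scaleR_add_left mult.commute)

lemma norm_op_exp: "norm (op_exp A t x) \<le> exp (\<bar>t\<bar> * norm A) * norm x"
  using norm_blinop_apply[of "exp (t *\<^sub>R A)" x] norm_exp[of "t *\<^sub>R A"]
  by (simp add: op_exp_def) (meson mult_right_mono norm_ge_zero order_trans)

text \<open>Used with complex scalars as \<open>K\<close>, which gives complex linearity of the
  group, and with the geometric weight, which controls the group in the Sobolev space.\<close>

lemma op_exp_intertwine:
  fixes A B :: "'a::{banach, perfect_space} blinop"
  assumes "\<And>x. K (blinop_apply A x) = blinop_apply B (K x)" and K: "bounded_linear K"
  shows "K (op_exp A t x) = op_exp B t (K x)"
proof -
  have "Blinop K * A = B * Blinop K"
    by (rule blinop_eqI) (simp add: assms blinop_apply_Blinop)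
  then have "Blinop K * (t *\<^sub>R A) = (t *\<^sub>R B) * Blinop K"
    by simp
  then have "blinop_apply (Blinop K * exp (t *\<^sub>R A)) x = blinop_apply (exp (t *\<^sub>R B) * Blinop K) x"
    by (simp only: exp_intertwine)
  then show ?thesis
    by (simp add: op_exp_def blinop_apply_Blinop K)
qed

lemma op_exp_has_vector_derivative:
  "((\<lambda>t. op_exp A t x) has_vector_derivative blinop_apply A (op_exp A t x)) (at t)"
  using bounded_linear.has_vector_derivative[OF bounded_linear_blinop_apply_left
      exp_scaleR_has_vector_derivative_left[of A t], of x]
  by (simp add: op_exp_def)

text \<open>By skew-symmetry of \<open>A\<close> the two terms of the product rule cancel, so the
  inner product along two orbits is constant in \<open>t\<close>.\<close>

lemma op_exp_isometry:
  fixes x y :: "'a::{real_inner, banach, perfect_space}"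
  assumes "\<And>x y. inner (blinop_apply A x) y = - inner x (blinop_apply A y)"
  shows "inner (op_exp A t x) (op_exp A t y) = inner x y"
proof -
  have "((\<lambda>t. inner (op_exp A t x) (op_exp A t y)) has_real_derivative 0) (at t)" for t
    using bounded_bilinear.has_vector_derivative[OF bounded_bilinear_inner
        op_exp_has_vector_derivative[of A x t] op_exp_has_vector_derivative[of A y t]]
    by (simp add: assms has_real_derivative_iff_has_vector_derivative)
  then show ?thesis
    using DERIV_isconst_all[of "\<lambda>t. inner (op_exp A t x) (op_exp A t y)" t 0] by simp
qed

section \<open>The Hilbert space of square-summable sequences\<close>

definition square_summable :: "(nat \<Rightarrow> complex) set" where
  "square_summable = {x. summable (\<lambda>n. (cmod (x n))\<^sup>2)}"

definition seq_inner :: "(nat \<Rightarrow> complex) \<Rightarrow> (nat \<Rightarrow> complex) \<Rightarrow> complex" where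
  "seq_inner x y = (\<Sum>n. x n * cnj (y n))"

lemma square_summable_zero: "(\<lambda>n. 0) \<in> square_summable"
  by (simp add: square_summable_def)

lemma square_summable_mult_bounded:
  assumes "x \<in> square_summable" "\<And>n. cmod (f n) \<le> K"
  shows "(\<lambda>n. f n * x n) \<in> square_summable"
proof -
  have "summable (\<lambda>n. K\<^sup>2 * (cmod (x n))\<^sup>2)"
    using assms(1) by (intro summable_mult) (simp add: square_summable_def)
  then show ?thesis
    unfolding square_summable_def mem_Collect_eq
    by (rule summable_comparison_test'[where N = 0])
      (simp add: norm_mult power_mult_distrib assms(2) mult_right_mono power_mono)
qed

lemma square_summable_scale: "x \<in> square_summable \<Longrightarrow> (\<lambda>n. a * x n) \<in> square_summable"
  by (rule square_summable_mult_bounded[of x "\<lambda>_. a" "cmod a"]) auto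

lemma square_summable_add:
  assumes "x \<in> square_summable" "y \<in> square_summable"
  shows "(\<lambda>n. x n + y n) \<in> square_summable"
proof -
  have sum: "summable (\<lambda>n. 2 * (cmod (x n))\<^sup>2 + 2 * (cmod (y n))\<^sup>2)"
    using assms by (intro summable_add summable_mult) (simp_all add: square_summable_def)
  have le: "(cmod (a + b))\<^sup>2 \<le> 2 * (cmod a)\<^sup>2 + 2 * (cmod b)\<^sup>2" for a b
  proof -
    have "(cmod (a + b))\<^sup>2 \<le> (cmod a + cmod b)\<^sup>2"
      by (intro power_mono norm_triangle_ineq) auto
    also have "\<dots> \<le> 2 * (cmod a)\<^sup>2 + 2 * (cmod b)\<^sup>2"
      using sum_squares_bound[of "cmod a" "cmod b"] by (simp add: power2_sum)
    finally show ?thesis .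
  qed
  show ?thesis
    unfolding square_summable_def mem_Collect_eq
    by (rule summable_comparison_test'[OF sum, where N = 0]) (simp add: le)
qed

lemma square_summable_diff:
  "\<lbrakk>x \<in> square_summable; y \<in> square_summable\<rbrakk> \<Longrightarrow> (\<lambda>n. x n - y n) \<in> square_summable"
  using square_summable_add[of x "\<lambda>n. - 1 * y n"] square_summable_scale[of y "- 1"] by simp

lemma square_summable_finite_support:
  assumes "\<And>n. n \<ge> N \<Longrightarrow> x n = 0"
  shows "x \<in> square_summable"
  unfolding square_summable_def mem_Collect_eq
  by (rule summable_finite[of "{..<N}"]) (use assms in \<open>auto simp: not_less\<close>)

lemma summable_seq_inner:
  assumes "x \<in> square_summable" "y \<in> square_summable"
  shows "summable (\<lambda>n. x n * cnj (y n))"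
proof -
  have sum: "summable (\<lambda>n. (cmod (x n))\<^sup>2 + (cmod (y n))\<^sup>2)"
    using assms by (intro summable_add) (simp_all add: square_summable_def)
  have le: "cmod a * cmod b \<le> (cmod a)\<^sup>2 + (cmod b)\<^sup>2" for a b
  proof -
    have "0 \<le> cmod a * cmod b" by simp
    then show ?thesis
      using sum_squares_bound[of "cmod a" "cmod b"] by linarith
  qed
  show ?thesis
    by (rule summable_comparison_test'[OF sum, where N = 0]) (simp add: norm_mult le)
qed

lemma seq_inner_add_left:
  "\<lbrakk>x \<in> square_summable; y \<in> square_summable; z \<in> square_summable\<rbrakk> \<Longrightarrow>
    seq_inner (\<lambda>n. x n + y n) z = seq_inner x z + seq_inner y z"
  unfolding seq_inner_def by (simp add: suminf_add summable_seq_inner distrib_right)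

lemma seq_inner_scale_left:
  "\<lbrakk>x \<in> square_summable; y \<in> square_summable\<rbrakk> \<Longrightarrow>
    seq_inner (\<lambda>n. a * x n) y = a * seq_inner x y"
  unfolding seq_inner_def
  by (simp add: suminf_mult[OF summable_seq_inner, symmetric] mult.assoc)

lemma seq_inner_commute:
  "\<lbrakk>x \<in> square_summable; y \<in> square_summable\<rbrakk> \<Longrightarrow> seq_inner x y = cnj (seq_inner y x)"
  unfolding seq_inner_def
  using sums_cnj[THEN iffD2, OF summable_sums[OF summable_seq_inner[of y x]]]
  by (auto simp: sums_iff mult.commute)

lemma seq_inner_self: 
  assumes "x \<in> square_summable" 
  shows "seq_inner x x = complex_of_real (\<Sum>n. (cmod (x n))\<^sup>2)"
proof -
  have "x n * cnj (x n) = complex_of_real ((cmod (x n))\<^sup>2)" for n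
    by (simp only: complex_norm_square)
  then show ?thesis
    using assms unfolding seq_inner_def square_summable_def
    by (simp only: suminf_of_real mem_Collect_eq)
qed

text \<open>A type for the carrier gives access to the class-based theory of Cauchy sequences,
  derivatives and \<open>exp\<close>; \<open>seq_of\<close> leads back to the bare sequences of the
  statement.\<close>

typedef l2 = square_summable
  morphisms seq_of Abs_l2
  using square_summable_zero by blast

setup_lifting type_definition_l2

lemma seq_of_square_summable [simp]: "seq_of x \<in> square_summable"
  by (rule seq_of)

lemma summable_norm_seq_of: "summable (\<lambda>n. (cmod (seq_of x n))\<^sup>2)"
  using seq_of[of x] by (simp add: square_summable_def)

lemma l2_eqI: "(\<And>n. seq_of x n = seq_of y n) \<Longrightarrow> x = y"
  by (simp add: seq_of_inject[symmetric] fun_eq_iff)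

text \<open>The classes know real scalars only, so the inner product here is the real part of
  \<open>seq_inner\<close>. \<open>cscale\<close> and \<open>seq_inner_conv_inner\<close> recover
  the complex structure.\<close>

instantiation l2 :: real_inner
begin

lift_definition zero_l2 :: l2 is "\<lambda>n. 0" by (rule square_summable_zero)
lift_definition plus_l2 :: "l2 \<Rightarrow> l2 \<Rightarrow> l2" is "\<lambda>x y n. x n + y n" by (rule square_summable_add)
lift_definition uminus_l2 :: "l2 \<Rightarrow> l2" is "\<lambda>x n. - x n" by (simp add: square_summable_def)
lift_definition minus_l2 :: "l2 \<Rightarrow> l2 \<Rightarrow> l2" is "\<lambda>x y n. x n - y n"
  by (rule square_summable_diff)
lift_definition scaleR_l2 :: "real \<Rightarrow> l2 \<Rightarrow> l2" is "\<lambda>r x n. complex_of_real r * x n"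
  by (rule square_summable_scale)
definition inner_l2 :: "l2 \<Rightarrow> l2 \<Rightarrow> real" where
  "inner_l2 x y = Re (seq_inner (seq_of x) (seq_of y))"
definition norm_l2 :: "l2 \<Rightarrow> real" where "norm_l2 x = sqrt (inner x x)"
definition dist_l2 :: "l2 \<Rightarrow> l2 \<Rightarrow> real" where "dist_l2 x y = norm (x - y)"
definition sgn_l2 :: "l2 \<Rightarrow> l2" where "sgn_l2 x = scaleR (inverse (norm x)) x"
definition uniformity_l2 :: "(l2 \<times> l2) filter" where
  "uniformity_l2 = (INF e\<in>{0<..}. principal {(x, y). dist x y < e})"
definition open_l2 :: "l2 set \<Rightarrow> bool" where
  "open_l2 S = (\<forall>x\<in>S. \<forall>\<^sub>F (x', y) in uniformity. x' = x \<longrightarrow> y \<in> S)"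

instance
proof
  fix x y z :: l2 and a b :: real
  show "x + y + z = x + (y + z)" "x + y = y + x" "0 + x = x" "- x + x = 0"
    by (transfer; simp add: algebra_simps)+
  show "x - y = x + - y"
    by transfer simp
  show scale: "a *\<^sub>R (x + y) = a *\<^sub>R x + a *\<^sub>R y" "(a + b) *\<^sub>R x = a *\<^sub>R x + b *\<^sub>R x"
    "a *\<^sub>R b *\<^sub>R x = (a * b) *\<^sub>R x" "1 *\<^sub>R x = x"
    by (transfer; simp add: algebra_simps)+
  show "inner x y = inner y x"
    using seq_inner_commute[of "seq_of x" "seq_of y"] by (simp add: inner_l2_def)
  show "inner (x + y) z = inner x z + inner y z"
    by (simp add: inner_l2_def plus_l2.rep_eq seq_inner_add_left)
  show "inner (a *\<^sub>R x) y = a * inner x y"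
    by (simp add: inner_l2_def scaleR_l2.rep_eq seq_inner_scale_left)
  show "0 \<le> inner x x"
    by (simp add: inner_l2_def seq_inner_self suminf_nonneg summable_norm_seq_of)
  show "inner x x = 0 \<longleftrightarrow> x = 0"
  proof -
    have "inner x x = 0 \<longleftrightarrow> (\<forall>n. seq_of x n = 0)"
      using suminf_eq_zero_iff[OF summable_norm_seq_of[of x]]
      by (simp add: inner_l2_def seq_inner_self)
    also have "\<dots> \<longleftrightarrow> x = 0"
      using l2_eqI[of x 0] by (auto simp: zero_l2.rep_eq)
    finally show ?thesis .
  qed
next
  show "dist x y = norm (x - y)" for x y :: l2
    by (rule dist_l2_def)
  show "sgn x = inverse (norm x) *\<^sub>R x" for x :: l2
    by (rule sgn_l2_def)
  show "norm x = sqrt (inner x x)" for x :: l2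
    by (rule norm_l2_def)
  show "uniformity = (INF e\<in>{0<..}. principal {(x, y :: l2). dist x y < e})"
    by (rule uniformity_l2_def)
  show "open S \<longleftrightarrow> (\<forall>x\<in>S. \<forall>\<^sub>F (x', y) in uniformity. x' = x \<longrightarrow> y \<in> S)" for S :: "l2 set"
    by (rule open_l2_def)
qed

end

lemma seq_of_simps [simp]:
  "seq_of 0 n = 0" "seq_of (x + y) n = seq_of x n + seq_of y n" "seq_of (- x) n = - seq_of x n"
  "seq_of (x - y) n = seq_of x n - seq_of y n" "seq_of (r *\<^sub>R x) n = complex_of_real r * seq_of x n"
  by (simp_all add: zero_l2.rep_eq plus_l2.rep_eq uminus_l2.rep_eq minus_l2.rep_eq scaleR_l2.rep_eq)

lemma norm_l2_eq: "norm x = sqrt (\<Sum>n. (cmod (seq_of x n))\<^sup>2)"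
  by (simp add: norm_l2_def inner_l2_def seq_inner_self)

lemma norm_l2_power2: "(norm x)\<^sup>2 = (\<Sum>n. (cmod (seq_of x n))\<^sup>2)" for x :: l2
  by (simp add: norm_l2_eq suminf_nonneg summable_norm_seq_of)

lemma sum_seq_of_le: "(\<Sum>n<N. (cmod (seq_of x n))\<^sup>2) \<le> (norm x)\<^sup>2"
  unfolding norm_l2_power2 by (rule sum_le_suminf) (auto simp: summable_norm_seq_of)

lemma seq_of_le_norm: "cmod (seq_of x n) \<le> norm x"
proof (rule power2_le_imp_le)
  have "(cmod (seq_of x n))\<^sup>2 \<le> (\<Sum>k<Suc n. (cmod (seq_of x k))\<^sup>2)"
    by (rule member_le_sum) auto
  then show "(cmod (seq_of x n))\<^sup>2 \<le> (norm x)\<^sup>2"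
    using sum_seq_of_le[where N = "Suc n"] order_trans by blast
qed simp

text \<open>Partial sums increase to the squared norm, so norm estimates reduce to finite
  sums.\<close>

lemma norm_l2_leI:
  assumes "\<And>N. (\<Sum>n<N. (cmod (seq_of x n))\<^sup>2) \<le> r\<^sup>2" "0 \<le> r"
  shows "norm x \<le> r"
  by (rule power2_le_imp_le[OF _ assms(2)])
    (auto simp: norm_l2_power2 summable_norm_seq_of intro!: suminf_le_const assms(1))

instance l2 :: banach
proof
  fix f :: "nat \<Rightarrow> l2"
  assume f: "Cauchy f"
  have "Cauchy (\<lambda>k. seq_of (f k) n)" for n
  proof (rule CauchyI)
    fix e :: real
    assume "0 < e"
    then obtain M where M: "\<And>j k. j \<ge> M \<Longrightarrow> k \<ge> M \<Longrightarrow> norm (f j - f k) < e"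
      using CauchyD[OF f] by blast
    have "cmod (seq_of (f j) n - seq_of (f k) n) < e" if "j \<ge> M" "k \<ge> M" for j k
      using M[OF that] seq_of_le_norm[of "f j - f k" n] by simp
    then show "\<exists>M. \<forall>j\<ge>M. \<forall>k\<ge>M. cmod (seq_of (f j) n - seq_of (f k) n) < e"
      by blast
  qed
  then have "\<forall>n. \<exists>a. (\<lambda>k. seq_of (f k) n) \<longlonglongrightarrow> a"
    by (auto simp: Cauchy_convergent_iff convergent_def)
  then obtain l where l: "\<And>n. (\<lambda>k. seq_of (f k) n) \<longlonglongrightarrow> l n"
    by metis
  \<comment> \<open>In the finite sums for \<open>f j - f k\<close> the limit in \<open>k\<close>
    can be taken coordinatewise. The bound is uniform in \<open>N\<close>, which gives both
    square-summability of \<open>l\<close> and convergence in norm.\<close>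
  have tail: "\<exists>M. \<forall>j\<ge>M. \<forall>N. (\<Sum>n<N. (cmod (seq_of (f j) n - l n))\<^sup>2) \<le> e\<^sup>2" if e: "0 < e" for e
  proof -
    obtain M where M: "\<And>j k. j \<ge> M \<Longrightarrow> k \<ge> M \<Longrightarrow> norm (f j - f k) < e"
      using CauchyD[OF f e] by blast
    have "(\<Sum>n<N. (cmod (seq_of (f j) n - l n))\<^sup>2) \<le> e\<^sup>2" if "j \<ge> M" for j N
    proof (rule tendsto_upperbound)
      show "(\<lambda>k. \<Sum>n<N. (cmod (seq_of (f j) n - seq_of (f k) n))\<^sup>2) \<longlonglongrightarrow>
          (\<Sum>n<N. (cmod (seq_of (f j) n - l n))\<^sup>2)"
        by (intro tendsto_intros l)
      have "(\<Sum>n<N. (cmod (seq_of (f j) n - seq_of (f k) n))\<^sup>2) \<le> e\<^sup>2" if "k \<ge> M" for k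
      proof -
        have "(\<Sum>n<N. (cmod (seq_of (f j) n - seq_of (f k) n))\<^sup>2) \<le> (norm (f j - f k))\<^sup>2"
          using sum_seq_of_le[of "f j - f k" N] by simp
        also have "\<dots> \<le> e\<^sup>2"
          using M[OF \<open>j \<ge> M\<close> that] by (intro power_mono) auto
        finally show ?thesis .
      qed
      then show "\<forall>\<^sub>F k in sequentially. (\<Sum>n<N. (cmod (seq_of (f j) n - seq_of (f k) n))\<^sup>2) \<le> e\<^sup>2"
        by (auto simp: eventually_sequentially)
    qed simp
    then show ?thesis by blast
  qed
  have "l \<in> square_summable"
  proof -
    obtain M where "\<And>N. (\<Sum>n<N. (cmod (seq_of (f M) n - l n))\<^sup>2) \<le> 1"
      using tail[of 1] by auto
    then have "summable (\<lambda>n. (cmod (seq_of (f M) n - l n))\<^sup>2)"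
      by (intro summableI_nonneg_bounded) auto
    \<comment> \<open>\<open>l\<close> is recovered as \<open>f M\<close> minus its square-summable
      difference from \<open>l\<close>.\<close>
    then have "(\<lambda>n. (-1) * (seq_of (f M) n - l n)) \<in> square_summable"
      by (intro square_summable_scale) (simp add: square_summable_def)
    from square_summable_add[OF seq_of_square_summable[of "f M"] this] show ?thesis
      by simp
  qed
  then have seq_of_l: "seq_of (Abs_l2 l) = l"
    by (rule Abs_l2_inverse)
  have "f \<longlonglongrightarrow> Abs_l2 l"
  proof (rule LIMSEQ_I)
    fix r :: real
    assume "0 < r"
    then obtain M where "\<And>j N. j \<ge> M \<Longrightarrow> (\<Sum>n<N. (cmod (seq_of (f j) n - l n))\<^sup>2) \<le> (r / 2)\<^sup>2"
      using tail[of "r / 2"] by auto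
    then have "norm (f j - Abs_l2 l) \<le> r / 2" if "j \<ge> M" for j
      using that \<open>0 < r\<close> by (intro norm_l2_leI) (simp_all add: seq_of_l)
    then show "\<exists>M. \<forall>j\<ge>M. norm (f j - Abs_l2 l) < r"
      using \<open>0 < r\<close> by (intro exI[of _ M]) fastforce
  qed
  then show "convergent f"
    by (rule convergentI)
qed

section \<open>Finitely supported sequences, density and separability\<close>

lift_definition single :: "nat \<Rightarrow> complex \<Rightarrow> l2" is "\<lambda>k a n. if n = k then a else 0"
proof -
  show "(\<lambda>n. if n = k then a else 0) \<in> square_summable" for k :: nat and a
    by (rule square_summable_finite_support[of "Suc k"]) auto
qed

lemma seq_of_single: "seq_of (single k a) n = (if n = k then a else 0)"
  by (simp add: single.rep_eq)

lemma seq_inner_single_right [simp]: "seq_inner x (seq_of (single k a)) = x k * cnj a"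
  using suminf_finite[of "{k}" "\<lambda>n. x n * cnj (seq_of (single k a) n)"]
  by (simp add: seq_inner_def seq_of_single)

lemma seq_inner_single_left [simp]: "seq_inner (seq_of (single k a)) x = a * cnj (x k)"
  using suminf_finite[of "{k}" "\<lambda>n. seq_of (single k a) n * cnj (x n)"]
  by (simp add: seq_inner_def seq_of_single)

lemma norm_single [simp]: "norm (single k a) = cmod a"
  by (simp add: norm_l2_def inner_l2_def seq_of_single cmod_def power2_eq_square)

lemma bounded_linear_single: "bounded_linear (single k)"
  by (rule bounded_linear_intro[where K = 1]) (auto intro!: l2_eqI simp: seq_of_single scaleR_conv_of_real)

text \<open>A small multiple of a basis vector leads away from any point. The instance makes the
  bounded operators on \<open>l2\<close> a normed algebra with unit.\<close>

instance l2 :: perfect_space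
proof
  fix x :: l2
  show "\<not> open {x}"
  proof
    assume "open {x}"
    then obtain e where e: "e > 0" "\<And>y. dist y x < e \<Longrightarrow> y = x"
      by (auto simp: open_dist)
    have "x + (e / 2) *\<^sub>R single 0 1 = x"
      using e(1) by (intro e(2)) (simp add: dist_norm)
    then have "(e / 2) *\<^sub>R single 0 1 = 0"
      by (metis add_0_right add_left_cancel)
    then have "norm ((e / 2) *\<^sub>R single 0 1) = 0"
      by (simp only: norm_zero)
    then show False
      using e(1) by simp
  qed
qed

lemma seq_of_sum: "seq_of (\<Sum>k\<in>A. f k) n = (\<Sum>k\<in>A. seq_of (f k) n)"
  by (induction A rule: infinite_finite_induct) auto

text \<open>Arbitrary sequences are allowed, since \<open>countable_dense_l2\<close> truncates
  members of a dense set of the full product space.\<close>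

definition truncation :: "nat \<Rightarrow> (nat \<Rightarrow> complex) \<Rightarrow> l2" where
  "truncation N x = (\<Sum>k<N. single k (x k))"

lemma seq_of_truncation: "seq_of (truncation N x) n = (if n < N then x n else 0)"
  by (simp add: truncation_def seq_of_sum seq_of_single)

lemma truncation_tendsto: "(\<lambda>N. truncation N (seq_of x)) \<longlonglongrightarrow> x"
proof -
  \<comment> \<open>Pythagoras: the error of the truncation carries what the first \<open>N\<close>
    entries leave of the squared norm.\<close>
  have eq: "(norm (truncation N (seq_of x) - x))\<^sup>2 = (norm x)\<^sup>2 - (\<Sum>n<N. (cmod (seq_of x n))\<^sup>2)" for N
  proof -
    have "(\<lambda>n. if n \<in> {..<N} then (cmod (seq_of x n))\<^sup>2 else 0) sums (\<Sum>n<N. (cmod (seq_of x n))\<^sup>2)"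
      by (rule sums_If_finite_set) simp
    from sums_diff[OF summable_sums[OF summable_norm_seq_of[of x]] this]
    moreover have "(cmod (seq_of x n))\<^sup>2 - (if n \<in> {..<N} then (cmod (seq_of x n))\<^sup>2 else 0) =
        (cmod (seq_of (truncation N (seq_of x) - x) n))\<^sup>2" for n
      by (simp add: seq_of_truncation)
    ultimately have "(\<lambda>n. (cmod (seq_of (truncation N (seq_of x) - x) n))\<^sup>2) sums
        ((norm x)\<^sup>2 - (\<Sum>n<N. (cmod (seq_of x n))\<^sup>2))"
      by (simp only: norm_l2_power2)
    then show ?thesis
      unfolding norm_l2_power2[of "truncation N (seq_of x) - x"] by (rule sums_unique[symmetric])
  qed
  have "(\<lambda>N. (norm x)\<^sup>2 - (\<Sum>n<N. (cmod (seq_of x n))\<^sup>2)) \<longlonglongrightarrow> (norm x)\<^sup>2 - (norm x)\<^sup>2"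
    unfolding norm_l2_power2
    by (intro tendsto_diff tendsto_const summable_LIMSEQ summable_norm_seq_of)
  then have "(\<lambda>N. (norm (truncation N (seq_of x) - x))\<^sup>2) \<longlonglongrightarrow> 0"
    unfolding eq by simp
  from tendsto_real_sqrt[OF this] show ?thesis
    by (simp add: tendsto_norm_zero_iff LIM_zero_iff)
qed

text \<open>The product space of all sequences has a countable dense set \<open>D0\<close>. Each
  truncation is continuous from there to \<open>l2\<close>, so the truncations of \<open>D0\<close>
  approximate all truncated sequences, and these are dense.\<close>

lemma countable_dense_l2: "\<exists>D :: l2 set. countable D \<and> closure D = UNIV"
proof -
  obtain D0 :: "(nat \<Rightarrow> complex) set"
    where D0: "countable D0" "\<And>S. open S \<Longrightarrow> S \<noteq> {} \<Longrightarrow> \<exists>d\<in>D0. d \<in> S"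
    using countable_dense_exists by blast
  have closure_D0: "closure D0 = UNIV"
    using D0(2)[of "- closure D0"] closure_subset[of D0] by auto
  define D where "D = (\<Union>N. truncation N ` D0)"
  have "continuous_on UNIV (truncation N)" for N
    unfolding truncation_def
    by (intro continuous_on_sum bounded_linear.continuous_on[OF bounded_linear_single]
        continuous_on_product_coordinates)
  then have "truncation N ` closure D0 \<subseteq> closure D" for N
    by (rule image_closure_subset[OF continuous_on_subset])
      (auto simp: D_def intro!: closure_subset[THEN subsetD])
  then have "truncation N x \<in> closure D" for N x
    by (auto simp: closure_D0)
  then have "x \<in> closure D" for x
    using closed_sequentially[OF closed_closure _ truncation_tendsto] by blast
  moreover have "countable D"
    using D0(1) by (simp add: D_def)
  ultimately show ?thesis by blast
qed

section \<open>Sequence space as a Hilbert space object\<close>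

definition l2_space :: "(nat \<Rightarrow> complex) cinner_space" where
  "l2_space = \<lparr>carrier = square_summable, monoid.mult = (\<lambda>x y. x), one = (\<lambda>n. 0),
    ring.zero = (\<lambda>n. 0), add = (\<lambda>x y n. x n + y n), smult = (\<lambda>a x n. a * x n),
    cinner = seq_inner\<rparr>"

lemma l2_space_simps [simp]:
  "carrier l2_space = square_summable" "\<zero>\<^bsub>l2_space\<^esub> = (\<lambda>n. 0)"
  "x \<oplus>\<^bsub>l2_space\<^esub> y = (\<lambda>n. x n + y n)" "a \<odot>\<^bsub>l2_space\<^esub> x = (\<lambda>n. a * x n)"
  "cinner l2_space = seq_inner"
  by (simp_all add: l2_space_def)

lemma complex_ring_simps [simp]:
  "carrier complex_ring = UNIV" "a \<oplus>\<^bsub>complex_ring\<^esub> b = a + b"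
  "a \<otimes>\<^bsub>complex_ring\<^esub> b = a * b" "\<one>\<^bsub>complex_ring\<^esub> = 1" "\<zero>\<^bsub>complex_ring\<^esub> = 0"
  by (simp_all add: ring_of_type_algebra_def)

lemma square_summable_obtain:
  assumes "x \<in> square_summable"
  obtains u where "x = seq_of u"
  using assms Abs_l2_inverse by metis

lemma seq_inner_definite:
  assumes "x \<in> square_summable" "seq_inner x x = 0"
  shows "x = (\<lambda>n. 0)"
proof -
  obtain u where u: "x = seq_of u"
    using assms(1) by (rule square_summable_obtain)
  then have "inner u u = 0"
    using assms(2) by (simp add: inner_l2_def)
  then show ?thesis
    by (simp add: u zero_l2.rep_eq)
qed

interpretation l2_space: complex_inner_space l2_space
proof (intro complex_inner_space.intro moduleI complex_inner_space_axioms.intro abelian_groupI)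
  show "cring complex_ring"
    by (rule cring_from_type_algebra)
  fix x y z and a b :: complex
  assume x: "x \<in> carrier l2_space"
  then show "\<exists>y\<in>carrier l2_space. y \<oplus>\<^bsub>l2_space\<^esub> x = \<zero>\<^bsub>l2_space\<^esub>"
    using square_summable_scale[of x "- 1"] by (intro bexI[of _ "\<lambda>n. - 1 * x n"]) auto
  show "0 \<le> Re (cinner l2_space x x)"
    using x by (simp add: seq_inner_self suminf_nonneg square_summable_def)
  show "x = \<zero>\<^bsub>l2_space\<^esub>" if "cinner l2_space x x = 0"
    using x that by (simp add: seq_inner_definite)
  assume y: "y \<in> carrier l2_space"
  show "cinner l2_space x y = cnj (cinner l2_space y x)"
    using x y by (simp add: seq_inner_commute[of x y])
qed (simp_all add: square_summable_zero square_summable_add square_summable_scale algebra_simps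
  seq_inner_scale_left seq_inner_add_left)

lemma l2_space_minus [simp]:
  "\<lbrakk>x \<in> square_summable; y \<in> square_summable\<rbrakk> \<Longrightarrow> x \<ominus>\<^bsub>l2_space\<^esub> y = (\<lambda>n. x n - y n)"
  using l2_space.uminus_eq_smult[of y] by (simp add: a_minus_def)

lemma hnorm_l2_space [simp]: "hnorm l2_space (seq_of u) = norm u"
  by (simp add: hnorm_def norm_l2_def inner_l2_def)

lemma seq_of_diff: "(\<lambda>n. seq_of u n - seq_of v n) = seq_of (u - v)"
  by (simp add: minus_l2.rep_eq)

lemma hdist_l2_space [simp]: "hdist l2_space (seq_of u) (seq_of v) = dist u v"
  by (simp add: hdist_def seq_of_diff dist_norm)

text \<open>This is \<open>htopology l2_space\<close> with the carrier rewritten, as it appears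
  after simplification.\<close>

abbreviation l2_topology :: "(nat \<Rightarrow> complex) topology" where
  "l2_topology \<equiv> Metric_space.mtopology square_summable (hdist l2_space)"

lemma limitin_l2_topology:
  "limitin l2_topology (\<lambda>t. seq_of (f t)) (seq_of l) F \<longleftrightarrow> (f \<longlongrightarrow> l) F"
  using l2_space.limitin_metric[of "\<lambda>t. seq_of (f t)" "seq_of l" F] by (simp add: tendsto_iff)

lemma closure_of_l2_topology: "(closure_of) l2_topology (seq_of ` S) = seq_of ` closure S"
proof -
  have "x \<in> (closure_of) l2_topology (seq_of ` S) \<longleftrightarrow>
      x \<in> square_summable \<and> (\<forall>r>0. \<exists>v\<in>S. hdist l2_space x (seq_of v) < r)" for x
    using l2_space.metric_closure_of[of "seq_of ` S"]
    by (auto simp: l2_space.in_mball[unfolded l2_space_simps(1)])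
  then show ?thesis
    by (auto simp: closure_approachable dist_commute image_iff seq_of_inject
        elim!: square_summable_obtain)
qed

lemma separable_hilbert_space_l2_space: "separable_hilbert_space l2_space"
proof (intro separable_hilbert_space.intro separable_hilbert_space_axioms.intro)
  show "complex_inner_space l2_space" ..
  show "Metric_space.mcomplete (carrier l2_space) (hdist l2_space)"
    unfolding l2_space.mcomplete_def
  proof (intro allI impI)
    fix f
    assume f: "Metric_space.MCauchy (carrier l2_space) (hdist l2_space) f"
    define u where "u n = Abs_l2 (f n)" for n
    have u: "f = (\<lambda>n. seq_of (u n))"
      using f[unfolded l2_space.MCauchy_def]
      by (auto simp: u_def Abs_l2_inverse image_subset_iff)
    have "Cauchy u"
      using f[unfolded l2_space.MCauchy_def] by (simp add: u Cauchy_def)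
    then obtain l where "u \<longlonglongrightarrow> l"
      using Cauchy_convergent_iff convergent_def by blast
    then show "\<exists>x. limitin (htopology l2_space) f x sequentially"
      unfolding u using limitin_l2_topology by auto
  qed
  obtain D :: "l2 set" where D: "countable D" "closure D = UNIV"
    using countable_dense_l2 by blast
  have "(closure_of) l2_topology (seq_of ` D) = square_summable"
    by (auto simp: closure_of_l2_topology D(2) elim: square_summable_obtain)
  then show "separable_space (htopology l2_space)"
    using l2_space.topspace_mtopology unfolding separable_space_def
    by (intro exI[of _ "seq_of ` D"]) (auto simp: D(1))
qed

lemma finsum_l2_space:
  "finite A \<Longrightarrow> (\<Oplus>\<^bsub>l2_space\<^esub>j\<in>A. seq_of (f j)) = seq_of (\<Sum>j\<in>A. f j)"
proof (induction A rule: finite_induct)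
  case empty
  then show ?case by (simp add: zero_l2.rep_eq)
next
  case (insert j A)
  then show ?case
    by (simp add: l2_space.M.finsum_insert Pi_def plus_l2.rep_eq)
qed

text \<open>The partial sums of the expansion are the truncations of \<open>x\<close>, which
  converge by \<open>truncation_tendsto\<close>.\<close>

lemma orthonormal_basis_l2_space: "orthonormal_basis l2_space (\<lambda>n. seq_of (single n 1))"
  unfolding orthonormal_basis_def
proof (intro conjI allI ballI)
  fix x
  assume "x \<in> carrier l2_space"
  then obtain u where u: "x = seq_of u"
    using square_summable_obtain by auto
  have "(\<lambda>n. seq_of u j * seq_of (single j 1) n) = seq_of (single j (seq_of u j))" for j
    by (auto simp: seq_of_single)
  then have "(\<Oplus>\<^bsub>l2_space\<^esub>j\<in>{..<n}. cinner l2_space x (seq_of (single j 1)) \<odot>\<^bsub>l2_space\<^esub> seq_of (single j 1))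
      = seq_of (truncation n x)" for n
    by (simp add: u finsum_l2_space truncation_def)
  then show "limitin (htopology l2_space) (\<lambda>n. \<Oplus>\<^bsub>l2_space\<^esub>j\<in>{..<n}.
      cinner l2_space x (seq_of (single j 1)) \<odot>\<^bsub>l2_space\<^esub> seq_of (single j 1)) x sequentially"
    using truncation_tendsto[of u] by (simp add: limitin_l2_topology u)
qed (simp_all add: seq_of_single)

section \<open>Multiplication operators\<close>

text \<open>The domain is maximal: on a smaller one the operator could be symmetric without being
  self-adjoint.\<close>

definition multiplication_operator :: "(nat \<Rightarrow> real) \<Rightarrow> (nat \<Rightarrow> complex) operator" where
  "multiplication_operator d =
    \<lparr>op_dom = {x \<in> square_summable. (\<lambda>n. complex_of_real (d n) * x n) \<in> square_summable},
     op_app = (\<lambda>x n. complex_of_real (d n) * x n)\<rparr>"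

lemma multiplication_operator_simps [simp]:
  "x \<in> op_dom (multiplication_operator d) \<longleftrightarrow>
    x \<in> square_summable \<and> (\<lambda>n. complex_of_real (d n) * x n) \<in> square_summable"
  "op_app (multiplication_operator d) x = (\<lambda>n. complex_of_real (d n) * x n)"
  by (simp_all add: multiplication_operator_def)

lemma truncation_in_dom_multiplication_operator:
  "seq_of (truncation N x) \<in> op_dom (multiplication_operator d)"
  using square_summable_finite_support[of N "\<lambda>n. complex_of_real (d n) * seq_of (truncation N x) n"]
  by (simp add: seq_of_truncation)

lemma single_in_dom_multiplication_operator:
  "seq_of (single k a) \<in> op_dom (multiplication_operator d)"
  using square_summable_finite_support[of "Suc k" "\<lambda>n. complex_of_real (d n) * seq_of (single k a) n"]
  by (simp add: seq_of_single)

lemma linear_multiplication_operator: "linear_operator l2_space (multiplication_operator d)"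
proof -
  have "submodule (op_dom (multiplication_operator d)) complex_ring l2_space"
  proof (rule l2_space.submoduleI)
    show "\<ominus>\<^bsub>l2_space\<^esub> x \<in> op_dom (multiplication_operator d)"
      if "x \<in> op_dom (multiplication_operator d)" for x
      using that square_summable_scale[of x "- 1"]
        square_summable_scale[of "\<lambda>n. complex_of_real (d n) * x n" "- 1"]
      by (simp add: l2_space.uminus_eq_smult)
    show "x \<oplus>\<^bsub>l2_space\<^esub> y \<in> op_dom (multiplication_operator d)"
      if "x \<in> op_dom (multiplication_operator d)" "y \<in> op_dom (multiplication_operator d)" for x y
      using that square_summable_add[of x y] square_summable_add[of
          "\<lambda>n. complex_of_real (d n) * x n" "\<lambda>n. complex_of_real (d n) * y n"]
      by (simp add: distrib_left)
    show "a \<odot>\<^bsub>l2_space\<^esub> x \<in> op_dom (multiplication_operator d)"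
      if "x \<in> op_dom (multiplication_operator d)" for a x
      using that square_summable_scale[of x a]
        square_summable_scale[of "\<lambda>n. complex_of_real (d n) * x n" a]
      by (simp add: mult.left_commute)
  qed (auto simp: square_summable_zero)
  then show ?thesis
    by (auto simp: linear_operator_def algebra_simps)
qed

text \<open>Truncations have finite support, hence lie in the domain for every \<open>d\<close>, and
  they are dense.\<close>

lemma densely_defined_multiplication_operator:
  "densely_defined l2_space (multiplication_operator d)"
proof -
  define S where "S = {u. seq_of u \<in> op_dom (multiplication_operator d)}"
  have dom: "op_dom (multiplication_operator d) = seq_of ` S"
    by (auto simp: S_def elim!: square_summable_obtain)
  have "u \<in> closure S" for u
    by (rule closed_sequentially[OF closed_closure _ truncation_tendsto])
      (use truncation_in_dom_multiplication_operator in
        \<open>auto simp: S_def simp del: multiplication_operator_simps intro!: closure_subset[THEN subsetD]\<close>)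
  then show ?thesis
    unfolding densely_defined_def dom
    by (auto simp: closure_of_l2_topology elim: square_summable_obtain)
qed

lemma self_adjoint_multiplication_operator: "self_adjoint l2_space (multiplication_operator d)"
proof -
  have "z = (\<lambda>n. complex_of_real (d n) * y n)"
    if "\<forall>x\<in>op_dom (multiplication_operator d).
        seq_inner (\<lambda>n. complex_of_real (d n) * x n) y = seq_inner x z" for y z
  proof
    fix k
    \<comment> \<open>Testing with the unit vectors determines \<open>z\<close> coordinate by
      coordinate. In the adjoint graph \<open>z\<close> is square-summable, so this also puts
      \<open>y\<close> into the maximal domain.\<close>
    have "(\<lambda>n. complex_of_real (d n) * seq_of (single k 1) n) = seq_of (single k (complex_of_real (d k)))"
      by (auto simp: seq_of_single)
    then have "complex_of_real (d k) * cnj (y k) = cnj (z k)"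
      using that[rule_format, OF single_in_dom_multiplication_operator[of k 1]] by simp
    then show "z k = complex_of_real (d k) * y k"
      by (metis complex_cnj_cnj complex_cnj_complex_of_real complex_cnj_mult)
  qed
  moreover have "seq_inner (\<lambda>n. complex_of_real (d n) * x n) y =
      seq_inner x (\<lambda>n. complex_of_real (d n) * y n)" for x y
    by (simp add: seq_inner_def mult_ac)
  ultimately have "adjoint_graph l2_space (multiplication_operator d) = op_graph (multiplication_operator d)"
    by (auto simp: adjoint_graph_def op_graph_def)
  then show ?thesis
    by (simp add: self_adjoint_def linear_multiplication_operator densely_defined_multiplication_operator)
qed

lemma positive_multiplication_operator:
  assumes "\<And>n. 0 < d n"
  shows "positive_operator l2_space (multiplication_operator d)"
  unfolding positive_operator_def
proof (intro ballI impI)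
  fix x
  assume "x \<in> op_dom (multiplication_operator d)" "x \<noteq> \<zero>\<^bsub>l2_space\<^esub>"
  then have x: "x \<in> square_summable" "(\<lambda>n. complex_of_real (d n) * x n) \<in> square_summable"
      and "\<exists>k. x k \<noteq> 0"
    by auto
  then obtain k where k: "x k \<noteq> 0" by blast
  have eq: "complex_of_real (d n) * x n * cnj (x n) = complex_of_real (d n * (cmod (x n))\<^sup>2)" for n
    by (simp only: complex_norm_square mult.assoc of_real_mult)
  have sum: "summable (\<lambda>n. d n * (cmod (x n))\<^sup>2)"
    using summable_seq_inner[OF x(2,1)] unfolding eq by (simp only: summable_of_real_iff)
  have "seq_inner (\<lambda>n. complex_of_real (d n) * x n) x = complex_of_real (\<Sum>n. d n * (cmod (x n))\<^sup>2)"
    unfolding seq_inner_def eq by (rule suminf_of_real[OF sum, symmetric])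
  moreover have "0 < (\<Sum>n. d n * (cmod (x n))\<^sup>2)"
    by (rule suminf_pos2[OF sum, of k]) (use assms k in \<open>auto simp: less_imp_le\<close>)
  ultimately show "0 < Re (cinner l2_space (op_app (multiplication_operator d) x) x)"
    by simp
qed

lemma hnorm_multiplication_operator_single:
  "hnorm l2_space (op_app (multiplication_operator d) (seq_of (single k 1))) = \<bar>d k\<bar>"
proof -
  have "(\<lambda>n. complex_of_real (d n) * seq_of (single k 1) n) = seq_of (single k (complex_of_real (d k)))"
    by (auto simp: seq_of_single)
  then show ?thesis
    by simp
qed

lemma unbounded_multiplication_operator:
  assumes "filterlim d at_top sequentially"
  shows "unbounded_operator l2_space (multiplication_operator d)"
  unfolding unbounded_operator_def
proof
  assume "\<exists>K. \<forall>x\<in>op_dom (multiplication_operator d).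
      hnorm l2_space (op_app (multiplication_operator d) x) \<le> K * hnorm l2_space x"
  \<comment> \<open>On the unit vectors the inequality would bound \<open>d\<close>.\<close>
  then obtain K where "\<And>k. \<bar>d k\<bar> \<le> K"
    using hnorm_multiplication_operator_single single_in_dom_multiplication_operator
    by (metis hnorm_l2_space mult.right_neutral norm_one norm_single)
  moreover obtain k where "d k \<ge> K + 1"
    using assms unfolding filterlim_at_top eventually_sequentially by blast
  ultimately show False
    by (smt (verit))
qed

lemma discrete_spectrum_multiplication_operator:
  assumes "0 < d 0" "incseq d" "filterlim d at_top sequentially"
  shows "discrete_spectrum l2_space (multiplication_operator d) d (\<lambda>n. seq_of (single n 1))"
  unfolding discrete_spectrum_def
proof (intro conjI allI assms orthonormal_basis_l2_space single_in_dom_multiplication_operator)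
  show "op_app (multiplication_operator d) (seq_of (single n 1)) =
      complex_of_real (d n) \<odot>\<^bsub>l2_space\<^esub> seq_of (single n 1)" for n
    by (auto simp: seq_of_single)
qed

section \<open>Shifts and diagonal operators\<close>

text \<open>The value 0 for unbounded multipliers makes the lifted map total.\<close>

lift_definition diag :: "(nat \<Rightarrow> complex) \<Rightarrow> l2 \<Rightarrow> l2" is
  "\<lambda>f x n. if bounded (range f) then f n * x n else 0"
proof -
  fix f x :: "nat \<Rightarrow> complex"
  assume x: "x \<in> square_summable"
  show "(\<lambda>n. if bounded (range f) then f n * x n else 0) \<in> square_summable"
  proof (cases "bounded (range f)")
    case True
    then obtain K where "\<And>n. cmod (f n) \<le> K"
      by (auto simp: bounded_iff)
    then show ?thesis
      using square_summable_mult_bounded[OF x, of f K] True by simp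
  qed (simp add: square_summable_zero)
qed

lemma seq_of_diag: "bounded (range f) \<Longrightarrow> seq_of (diag f u) n = f n * seq_of u n"
  by (simp add: diag.rep_eq)

lift_definition left_shift :: "l2 \<Rightarrow> l2" is "\<lambda>x n. x (Suc n)"
  by (simp add: square_summable_def summable_Suc_iff[of "\<lambda>n. (cmod (_ n))\<^sup>2"])

lift_definition right_shift :: "l2 \<Rightarrow> l2" is "\<lambda>x n. case n of 0 \<Rightarrow> 0 | Suc m \<Rightarrow> x m"
  unfolding square_summable_def mem_Collect_eq by (subst summable_Suc_iff[symmetric]) simp

lemma seq_of_left_shift [simp]: "seq_of (left_shift u) n = seq_of u (Suc n)"
  by (simp add: left_shift.rep_eq)

lemma seq_of_right_shift [simp]:
  "seq_of (right_shift u) 0 = 0" "seq_of (right_shift u) (Suc n) = seq_of u n"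
  by (simp_all add: right_shift.rep_eq)

lemma bounded_linear_diag:
  assumes "bounded (range f)"
  shows "bounded_linear (diag f)"
proof -
  obtain K where K: "\<And>n. cmod (f n) \<le> K"
    using assms by (auto simp: bounded_iff)
  have "0 \<le> K"
    using K[of 0] norm_ge_zero order_trans by blast
  show ?thesis
  proof (rule bounded_linear_intro)
    show "norm (diag f u) \<le> norm u * K" for u
    proof (rule norm_l2_leI)
      have "(\<Sum>n<N. (cmod (seq_of (diag f u) n))\<^sup>2) \<le> (\<Sum>n<N. K\<^sup>2 * (cmod (seq_of u n))\<^sup>2)" for N
        using K by (intro sum_mono)
          (simp add: seq_of_diag[OF assms] norm_mult power_mult_distrib mult_right_mono power_mono)
      also have "\<dots> N \<le> (norm u * K)\<^sup>2" for N
        using sum_seq_of_le[of u N]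
        by (simp add: sum_distrib_left[symmetric] power_mult_distrib mult.commute mult_left_mono)
      finally show "(\<Sum>n<N. (cmod (seq_of (diag f u) n))\<^sup>2) \<le> (norm u * K)\<^sup>2" for N .
    qed (simp add: \<open>0 \<le> K\<close>)
  qed (auto intro!: l2_eqI simp: seq_of_diag[OF assms] algebra_simps)
qed

lemma bounded_linear_left_shift: "bounded_linear left_shift"
proof (rule bounded_linear_intro)
  show "norm (left_shift u) \<le> norm u * 1" for u
  proof (rule norm_l2_leI)
    have "(\<Sum>n<N. (cmod (seq_of (left_shift u) n))\<^sup>2) \<le> (\<Sum>n<Suc N. (cmod (seq_of u n))\<^sup>2)" for N
      by (simp add: sum.lessThan_Suc_shift del: sum.lessThan_Suc)
    also have "\<dots> N \<le> (norm u * 1)\<^sup>2" for N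
      using sum_seq_of_le[of u "Suc N"] by simp
    finally show "(\<Sum>n<N. (cmod (seq_of (left_shift u) n))\<^sup>2) \<le> (norm u * 1)\<^sup>2" for N .
  qed simp
qed (auto intro!: l2_eqI)

lemma bounded_linear_right_shift: "bounded_linear right_shift"
proof (rule bounded_linear_intro)
  show "norm (right_shift u) \<le> norm u * 1" for u
  proof (rule norm_l2_leI)
    have "(\<Sum>n<N. (cmod (seq_of (right_shift u) n))\<^sup>2) \<le> (\<Sum>n<Suc N. (cmod (seq_of (right_shift u) n))\<^sup>2)" for N
      by simp
    also have "\<dots> N = (\<Sum>n<N. (cmod (seq_of u n))\<^sup>2)" for N
      by (simp add: sum.lessThan_Suc_shift del: sum.lessThan_Suc)
    also have "\<dots> N \<le> (norm u * 1)\<^sup>2" for N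
      using sum_seq_of_le[of u N] by simp
    finally show "(\<Sum>n<N. (cmod (seq_of (right_shift u) n))\<^sup>2) \<le> (norm u * 1)\<^sup>2" for N .
  qed simp
qed (rule l2_eqI, case_tac n; simp)+

text \<open>The term at 0 drops out because the right shift inserts a zero there; the two shifts are
  therefore adjoint to each other.\<close>

lemma seq_inner_right_shift:
  "seq_inner (seq_of (right_shift u)) (seq_of v) = seq_inner (seq_of u) (seq_of (left_shift v))"
  using suminf_split_head[OF summable_seq_inner[OF seq_of_square_summable[of "right_shift u"]
      seq_of_square_summable[of v]]]
  by (simp add: seq_inner_def)

lemma seq_inner_diag:
  assumes "bounded (range f)" "bounded (range g)" "\<And>n. g n = cnj (f n)"
  shows "seq_inner (seq_of (diag f u)) (seq_of v) = seq_inner (seq_of u) (seq_of (diag g v))"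
  unfolding seq_inner_def seq_of_diag[OF assms(1)] seq_of_diag[OF assms(2)] assms(3)
  by (simp add: mult_ac)

text \<open>Complex scalar multiplication on \<open>l2\<close>, whose classes provide real scalars
  only.\<close>

abbreviation cscale :: "complex \<Rightarrow> l2 \<Rightarrow> l2" where
  "cscale a \<equiv> diag (\<lambda>_. a)"

lemma seq_of_cscale [simp]: "seq_of (cscale a u) n = a * seq_of u n"
  by (simp add: seq_of_diag)

lemma bounded_linear_cscale: "bounded_linear (cscale a)"
  by (simp add: bounded_linear_diag)

text \<open>The product with \<open>\<i>\<close> times \<open>v\<close> is \<open>- \<i>\<close>
  times the one with \<open>v\<close>, and its real part is the missing imaginary part. Facts about
  the real \<open>inner\<close> thus extend to the complex product.\<close>

lemma seq_inner_conv_inner: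
  "seq_inner (seq_of u) (seq_of v) = Complex (inner u v) (inner u (cscale \<i> v))"
proof -
  have "seq_inner (seq_of u) (seq_of (cscale \<i> v)) = - \<i> * seq_inner (seq_of u) (seq_of v)"
    using seq_inner_diag[of "\<lambda>_. - \<i>" "\<lambda>_. \<i>" u v] seq_inner_scale_left[of "seq_of u" "seq_of v" "- \<i>"]
    by (simp add: diag.rep_eq)
  then show ?thesis
    by (simp add: inner_l2_def complex_eq_iff)
qed

section \<open>The operator with a single, slowly decaying eigenvector\<close>

text \<open>
  The coefficients are a solution of \<open>a\<^sub>n\<^sup>2 + b\<^sub>n\<^sup>2 = 2\<close> and \<open>b\<^sub>n a\<^sub>n\<^sub>+\<^sub>1 = 1\<close>: with \<open>b\<^sub>n\<^sup>2 = w\<^sub>n\<^sub>+\<^sub>1 / w\<^sub>n\<close> these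
  equations say that \<open>w\<close> is affine, and \<open>w\<^sub>n = n + 2\<close> keeps \<open>a\<^sub>0\<close> positive.
\<close>

definition coeff_a :: "nat \<Rightarrow> complex" where
  "coeff_a n = complex_of_real (sqrt ((real n + 1) / (real n + 2)))"

definition coeff_b :: "nat \<Rightarrow> complex" where
  "coeff_b n = complex_of_real (sqrt ((real n + 3) / (real n + 2)))"

lemma bounded_coeff_a: "bounded (range coeff_a)"
  by (rule boundedI[of _ 1]) (auto simp: coeff_a_def)

lemma bounded_coeff_b: "bounded (range coeff_b)"
proof (rule boundedI[of _ 2])
  fix z assume "z \<in> range coeff_b"
  then obtain n where z: "z = coeff_b n" by blast
  have "sqrt ((real n + 3) / (real n + 2)) \<le> sqrt 4"
    by (rule real_sqrt_le_mono) (simp add: field_simps)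
  then show "norm z \<le> 2"
    by (simp add: z coeff_b_def)
qed

lemma cnj_coeff [simp]: "cnj (coeff_a n) = coeff_a n" "cnj (coeff_b n) = coeff_b n"
  by (simp_all add: coeff_a_def coeff_b_def)

text \<open>
  The operators \<open>A\<close> and \<open>A*\<close> are the case \<open>w = 1\<close>. Other values of \<open>w\<close> arise by conjugation with a
  geometric weight.
\<close>

definition ladder :: "complex \<Rightarrow> l2 \<Rightarrow> l2" where
  "ladder w u = diag coeff_a u - cscale w (right_shift (diag coeff_b u))"

definition ladder_adj :: "complex \<Rightarrow> l2 \<Rightarrow> l2" where
  "ladder_adj w u = diag coeff_a u - cscale w (diag coeff_b (left_shift u))"

lemma seq_of_ladder [simp]:
  "seq_of (ladder w u) 0 = coeff_a 0 * seq_of u 0"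
  "seq_of (ladder w u) (Suc n) = coeff_a (Suc n) * seq_of u (Suc n) - w * (coeff_b n * seq_of u n)"
  by (simp_all add: ladder_def seq_of_diag bounded_coeff_a bounded_coeff_b)

lemma seq_of_ladder_adj [simp]:
  "seq_of (ladder_adj w u) n = coeff_a n * seq_of u n - w * (coeff_b n * seq_of u (Suc n))"
  by (simp add: ladder_adj_def seq_of_diag bounded_coeff_a bounded_coeff_b)

lemma bounded_linear_ladder: "bounded_linear (ladder w)"
  unfolding ladder_def
  by (intro bounded_linear_sub bounded_linear_compose[OF bounded_linear_cscale]
      bounded_linear_compose[OF bounded_linear_right_shift] bounded_linear_diag
      bounded_coeff_a bounded_coeff_b)

lemma bounded_linear_ladder_adj: "bounded_linear (ladder_adj w)"
  unfolding ladder_adj_def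
  by (intro bounded_linear_sub bounded_linear_compose[OF bounded_linear_cscale]
      bounded_linear_compose[OF bounded_linear_diag] bounded_linear_left_shift bounded_linear_diag
      bounded_coeff_a bounded_coeff_b)

lemma seq_inner_diff_left:
  "seq_inner (seq_of (u - v)) (seq_of w) = seq_inner (seq_of u) (seq_of w) - seq_inner (seq_of v) (seq_of w)"
  by (simp add: seq_inner_conv_inner complex_eq_iff inner_diff_left)

lemma seq_inner_diff_right:
  "seq_inner (seq_of w) (seq_of (u - v)) = seq_inner (seq_of w) (seq_of u) - seq_inner (seq_of w) (seq_of v)"
  using seq_inner_diff_left[of u v w] seq_inner_commute[of "seq_of w"] by simp

text \<open>The coefficients are real, so the diagonal factors are symmetric, and the right shift
  goes over to the left shift.\<close>

lemma seq_inner_ladder: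
  "seq_inner (seq_of (ladder 1 u)) (seq_of v) = seq_inner (seq_of u) (seq_of (ladder_adj 1 v))"
proof -
  have 1: "cscale 1 x = x" for x
    by (rule l2_eqI) simp
  have "seq_inner (seq_of (diag f x)) (seq_of y) = seq_inner (seq_of x) (seq_of (diag f y))"
    if "f \<in> {coeff_a, coeff_b}" for f x y
    using that
    by (intro seq_inner_diag) (auto simp: bounded_coeff_a bounded_coeff_b)
  then show ?thesis
    unfolding ladder_def ladder_adj_def 1 seq_inner_diff_left seq_inner_diff_right
      seq_inner_right_shift by simp
qed

section \<open>Bounded self-adjoint operators and their unitary groups\<close>

lemma seq_inner_cscale [simp]:
  "seq_inner (seq_of (cscale a u)) (seq_of v) = a * seq_inner (seq_of u) (seq_of v)"
  "seq_inner (seq_of u) (seq_of (cscale a v)) = cnj a * seq_inner (seq_of u) (seq_of v)"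
proof -
  show left: "seq_inner (seq_of (cscale a u)) (seq_of v) = a * seq_inner (seq_of u) (seq_of v)"
    for a u v
    using seq_inner_scale_left[of "seq_of u" "seq_of v" a] by (simp add: diag.rep_eq)
  show "seq_inner (seq_of u) (seq_of (cscale a v)) = cnj a * seq_inner (seq_of u) (seq_of v)"
    using left[of a v u] seq_inner_commute[of "seq_of u"] by simp
qed

lemma plus_seq_of: "(\<lambda>n. seq_of u n + seq_of v n) = seq_of (u + v)"
  by (simp add: plus_l2.rep_eq)

lemma scale_seq_of: "(\<lambda>n. a * seq_of u n) = seq_of (cscale a u)"
  by (auto simp: fun_eq_iff)

definition bounded_operator :: "(l2 \<Rightarrow> l2) \<Rightarrow> (nat \<Rightarrow> complex) operator" where
  "bounded_operator K = \<lparr>op_dom = square_summable, op_app = (\<lambda>x. seq_of (K (Abs_l2 x)))\<rparr>"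

lemma bounded_operator_simps [simp]:
  "op_dom (bounded_operator K) = square_summable"
  "op_app (bounded_operator K) x = seq_of (K (Abs_l2 x))"
  by (simp_all add: bounded_operator_def)

lemma submodule_l2_space: "submodule square_summable complex_ring l2_space"
  using l2_space.M.a_inv_closed
  by (intro l2_space.submoduleI)
    (auto simp: square_summable_zero square_summable_add square_summable_scale)

lemma linear_bounded_operator:
  assumes "bounded_linear K" "\<And>a u. K (cscale a u) = cscale a (K u)"
  shows "linear_operator l2_space (bounded_operator K)"
  unfolding linear_operator_def
proof (intro conjI ballI allI)
  show "submodule (op_dom (bounded_operator K)) complex_ring l2_space"
    by (simp add: submodule_l2_space)
  fix a x
  assume x: "x \<in> op_dom (bounded_operator K)"
  then obtain u where u: "x = seq_of u"
    using square_summable_obtain by auto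
  then show "op_app (bounded_operator K) (a \<odot>\<^bsub>l2_space\<^esub> x) =
      a \<odot>\<^bsub>l2_space\<^esub> op_app (bounded_operator K) x"
    by (simp add: scale_seq_of seq_of_inverse assms(2))
  fix y
  assume "y \<in> op_dom (bounded_operator K)"
  then obtain v where v: "y = seq_of v"
    using square_summable_obtain by auto
  show "op_app (bounded_operator K) (x \<oplus>\<^bsub>l2_space\<^esub> y) =
      op_app (bounded_operator K) x \<oplus>\<^bsub>l2_space\<^esub> op_app (bounded_operator K) y"
    using linear_add[OF bounded_linear.linear[OF assms(1)], of u v]
    by (simp add: u v plus_seq_of seq_of_inverse)
qed simp

lemma self_adjoint_bounded_operator:
  assumes "bounded_linear K" "\<And>a u. K (cscale a u) = cscale a (K u)"
    and sym: "\<And>u v. seq_inner (seq_of (K u)) (seq_of v) = seq_inner (seq_of u) (seq_of (K v))"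
  shows "self_adjoint l2_space (bounded_operator K)"
proof -
  have "densely_defined l2_space (bounded_operator K)"
    using l2_space.topspace_mtopology closure_of_topspace[of l2_topology]
    by (simp add: densely_defined_def)
  moreover have "adjoint_graph l2_space (bounded_operator K) = op_graph (bounded_operator K)"
  proof (intro equalityI subsetI)
    fix p
    assume "p \<in> adjoint_graph l2_space (bounded_operator K)"
    then obtain y z where p: "p = (y, z)" "y \<in> square_summable" "z \<in> square_summable"
      and *: "\<And>x. x \<in> square_summable \<Longrightarrow> seq_inner (seq_of (K (Abs_l2 x))) y = seq_inner x z"
      by (auto simp: adjoint_graph_def)
    obtain v w where v: "y = seq_of v" and w: "z = seq_of w"
      using p square_summable_obtain by metis
    \<comment> \<open>By symmetry, pairing with the unit vector \<open>single k 1\<close> reads off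
      coordinate \<open>k\<close> of both \<open>K v\<close> and \<open>w\<close>.\<close>
    have "cnj (seq_of (K v) k) = cnj (seq_of w k)" for k
      using *[OF seq_of_square_summable[of "single k 1"]] sym[of "single k 1" v]
      by (simp add: v w seq_of_inverse)
    then have "K v = w"
      by (intro l2_eqI) simp
    then show "p \<in> op_graph (bounded_operator K)"
      by (auto simp: p v w op_graph_def seq_of_inverse)
  next
    fix p
    assume "p \<in> op_graph (bounded_operator K)"
    then obtain x where x: "x \<in> square_summable" "p = (x, seq_of (K (Abs_l2 x)))"
      by (auto simp: op_graph_def)
    obtain v where v: "x = seq_of v"
      using x square_summable_obtain by metis
    have "seq_inner (seq_of (K (Abs_l2 y))) (seq_of v) = seq_inner y (seq_of (K v))"
      if "y \<in> square_summable" for y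
      using that sym[of "Abs_l2 y" v] by (simp add: Abs_l2_inverse)
    then show "p \<in> adjoint_graph l2_space (bounded_operator K)"
      by (simp add: x(2) v adjoint_graph_def seq_of_inverse)
  qed
  ultimately show ?thesis
    by (simp add: self_adjoint_def linear_bounded_operator assms)
qed

text \<open>The operators in \<open>blinop\<close> are real-linear, but multiplication by
  \<open>\<i>\<close> is one of them, so the exponential of \<open>\<i> K\<close> can be formed in
  this real algebra.\<close>

definition i_times :: "(l2 \<Rightarrow> l2) \<Rightarrow> l2 blinop" where
  "i_times K = Blinop (\<lambda>u. cscale \<i> (K u))"

definition group_of :: "(l2 \<Rightarrow> l2) \<Rightarrow> real \<Rightarrow> (nat \<Rightarrow> complex) \<Rightarrow> nat \<Rightarrow> complex" where
  "group_of K t x = seq_of (op_exp (i_times K) t (Abs_l2 x))"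

lemma blinop_apply_i_times:
  "bounded_linear K \<Longrightarrow> blinop_apply (i_times K) u = cscale \<i> (K u)"
  unfolding i_times_def
  by (subst blinop_apply_Blinop) (auto intro: bounded_linear_compose[OF bounded_linear_cscale])

lemma cscale_commute: "cscale a (cscale b u) = cscale b (cscale a u)"
  by (rule l2_eqI) simp

text \<open>Puts the derivative at 0 into the form that \<open>unitary_group_generated_by\<close>
  asks for.\<close>

lemma difference_quotient_op_exp:
  "((\<lambda>t. (1 / t) *\<^sub>R (op_exp A t u - u)) \<longlongrightarrow> blinop_apply A u) (at 0)"
proof -
  have "((\<lambda>t. op_exp A t u) has_vector_derivative blinop_apply A u) (at 0)"
    using op_exp_has_vector_derivative[of A u 0] by simp
  then have "((\<lambda>t. norm (op_exp A t u - u - t *\<^sub>R blinop_apply A u) / norm t) \<longlongrightarrow> 0) (at 0)"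
    by (simp add: has_vector_derivative_def has_derivative_iff_norm)
  then have "((\<lambda>t. norm ((1 / t) *\<^sub>R (op_exp A t u - u) - blinop_apply A u)) \<longlongrightarrow> 0) (at 0)"
  proof (rule Lim_transform_eventually)
    have "norm (op_exp A t u - u - t *\<^sub>R blinop_apply A u) / norm t =
        norm ((1 / t) *\<^sub>R (op_exp A t u - u) - blinop_apply A u)" if "t \<noteq> 0" for t
    proof -
      have "(1 / t) *\<^sub>R (op_exp A t u - u) - blinop_apply A u =
          (1 / t) *\<^sub>R (op_exp A t u - u - t *\<^sub>R blinop_apply A u)"
        using that by (simp add: scaleR_diff_right)
      then show ?thesis by simp
    qed
    then show "\<forall>\<^sub>F t in at 0. norm (op_exp A t u - u - t *\<^sub>R blinop_apply A u) / norm t =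
        norm ((1 / t) *\<^sub>R (op_exp A t u - u) - blinop_apply A u)"
      by (auto simp: eventually_at intro!: exI[of _ 1])
  qed
  then show ?thesis
    by (simp add: tendsto_norm_zero_iff LIM_zero_iff)
qed

context
  fixes K :: "l2 \<Rightarrow> l2"
  assumes K: "bounded_linear K" "\<And>a u. K (cscale a u) = cscale a (K u)"
    and sym: "\<And>u v. seq_inner (seq_of (K u)) (seq_of v) = seq_inner (seq_of u) (seq_of (K v))"
begin

lemma group_of_linear:
  "linear_operator l2_space \<lparr>op_dom = square_summable, op_app = group_of K t\<rparr>"
proof -
  \<comment> \<open>The exponential is taken in a real algebra; complex linearity follows because
    \<open>K\<close> commutes with all scalars.\<close>
  have "cscale a (op_exp (i_times K) t u) = op_exp (i_times K) t (cscale a u)" for a u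
    by (rule op_exp_intertwine[OF _ bounded_linear_cscale])
      (simp add: blinop_apply_i_times K cscale_commute[of a])
  from linear_bounded_operator[OF bounded_linear_op_exp this[symmetric]] show ?thesis
    by (simp add: bounded_operator_def group_of_def[abs_def])
qed

text \<open>For symmetric \<open>K\<close> the operator \<open>\<i> K\<close> is skew with respect
  to the real inner product, so its exponential preserves that product. Commuting with
  \<open>\<i>\<close> then gives the complex one.\<close>

lemma group_of_inner:
  "seq_inner (seq_of (op_exp (i_times K) t u)) (seq_of (op_exp (i_times K) t v)) =
    seq_inner (seq_of u) (seq_of v)"
proof -
  have "inner (blinop_apply (i_times K) u) v = - inner u (blinop_apply (i_times K) v)" for u v
    using sym[of u v] by (simp add: blinop_apply_i_times K inner_l2_def)
  then have isom: "inner (op_exp (i_times K) t u) (op_exp (i_times K) t v) = inner u v" for u v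
    by (rule op_exp_isometry)
  have "cscale \<i> (op_exp (i_times K) t v) = op_exp (i_times K) t (cscale \<i> v)"
    by (rule op_exp_intertwine[OF _ bounded_linear_cscale]) (simp add: blinop_apply_i_times K)
  then show ?thesis
    by (simp add: seq_inner_conv_inner isom)
qed

lemma unitary_group_of: "unitary_group l2_space (group_of K)"
  unfolding unitary_group_def
proof (intro conjI allI ballI)
  have inv: "group_of K s (group_of K t x) = group_of K (s + t) x" for s t x
    by (simp add: group_of_def seq_of_inverse op_exp_add)
  have zero: "group_of K 0 x = x" if "x \<in> square_summable" for x
    using that by (simp add: group_of_def Abs_l2_inverse)
  show "unitary_on l2_space (group_of K t)" for t
    unfolding unitary_on_def
  proof (intro conjI ballI)
    show "linear_operator l2_space \<lparr>op_dom = carrier l2_space, op_app = group_of K t\<rparr>"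
      by (simp add: group_of_linear)
    \<comment> \<open>The inverse is the group at time \<open>- t\<close>.\<close>
    show "bij_betw (group_of K t) (carrier l2_space) (carrier l2_space)"
      by (rule bij_betwI[of _ _ _ "group_of K (- t)"]) (auto simp: inv zero, auto simp: group_of_def)
    show "cinner l2_space (group_of K t x) (group_of K t y) = cinner l2_space x y"
      if "x \<in> carrier l2_space" "y \<in> carrier l2_space" for x y
      using that by (simp add: group_of_def group_of_inner Abs_l2_inverse)
  qed
  show "group_of K 0 x = x" if "x \<in> carrier l2_space" for x
    using that by (simp add: zero)
  show "group_of K (s + t) x = group_of K s (group_of K t x)" for s t x
    by (simp add: inv)
  show "continuous_map euclideanreal (htopology l2_space) (\<lambda>t. group_of K t x)" for x
  proof -
    have "((\<lambda>s. op_exp (i_times K) s (Abs_l2 x)) \<longlongrightarrow> op_exp (i_times K) t (Abs_l2 x)) (at t)" for t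
      using has_vector_derivative_continuous[OF op_exp_has_vector_derivative] by (simp add: continuous_at)
    moreover have "atin euclideanreal t = at t" for t
      by (auto simp: filter_eq_iff eventually_atin eventually_at_topological)
    ultimately show ?thesis
      unfolding group_of_def[abs_def]
      by (simp add: continuous_map_atin limitin_l2_topology)
  qed
qed

lemma group_of_generated_by: "unitary_group_generated_by l2_space (bounded_operator K) (group_of K)"
  unfolding unitary_group_generated_by_def
proof (intro conjI ballI unitary_group_of)
  fix x y
  assume "x \<in> carrier l2_space" "y \<in> carrier l2_space"
  then obtain u v where u: "x = seq_of u" and v: "y = seq_of v"
    by (metis l2_space_simps(1) square_summable_obtain)
  have quot: "complex_of_real (1 / t) \<odot>\<^bsub>l2_space\<^esub> (group_of K t x \<ominus>\<^bsub>l2_space\<^esub> x) =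
      seq_of ((1 / t) *\<^sub>R (op_exp (i_times K) t u - u))" for t
    by (auto simp: u group_of_def seq_of_inverse)
  have lim: "((\<lambda>t. (1 / t) *\<^sub>R (op_exp (i_times K) t u - u)) \<longlongrightarrow> cscale \<i> (K u)) (at 0)"
    using difference_quotient_op_exp[of "i_times K" u] by (simp add: blinop_apply_i_times K)
  have "limitin (htopology l2_space) (\<lambda>t. complex_of_real (1 / t) \<odot>\<^bsub>l2_space\<^esub>
        (group_of K t x \<ominus>\<^bsub>l2_space\<^esub> x)) y (at 0) \<longleftrightarrow>
      ((\<lambda>t. (1 / t) *\<^sub>R (op_exp (i_times K) t u - u)) \<longlongrightarrow> v) (at 0)"
    unfolding quot v l2_space_simps(1) by (rule limitin_l2_topology)
  \<comment> \<open>Every orbit is differentiable at 0 with derivative \<open>lim\<close>, so the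
    equivalence is uniqueness of the limit.\<close>
  also have "\<dots> \<longleftrightarrow> v = cscale \<i> (K u)"
    using lim by (blast intro: tendsto_unique[OF at_neq_bot])
  also have "\<dots> \<longleftrightarrow> x \<in> op_dom (bounded_operator K) \<and>
      y = \<i> \<odot>\<^bsub>l2_space\<^esub> op_app (bounded_operator K) x"
    by (simp add: u v seq_of_inverse scale_seq_of seq_of_inject)
  finally show "limitin (htopology l2_space) (\<lambda>t. complex_of_real (1 / t) \<odot>\<^bsub>l2_space\<^esub>
        (group_of K t x \<ominus>\<^bsub>l2_space\<^esub> x)) y (at 0) \<longleftrightarrow>
      x \<in> op_dom (bounded_operator K) \<and> y = \<i> \<odot>\<^bsub>l2_space\<^esub> op_app (bounded_operator K) x" .
qed

end

section \<open>Sobolev bounds and eigenvectors\<close>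

text \<open>The power \<open>-1/2\<close> of the multiplication by \<open>4\<^sup>n\<close>, an isometry from \<open>\<ell>\<^sup>2\<close> onto \<open>H\<^sup>1\<close>.\<close>

definition weight :: "l2 \<Rightarrow> l2" where
  "weight = diag (\<lambda>n. (1 / 2) ^ n)"

lemma bounded_weight: "bounded (range (\<lambda>n. (1 / 2 :: complex) ^ n))"
  by (rule boundedI[of _ 1]) (auto simp: norm_power norm_divide power_le_one)

lemma bounded_linear_weight: "bounded_linear weight"
  by (simp add: weight_def bounded_linear_diag bounded_weight)

lemma seq_of_weight [simp]: "seq_of (weight u) n = (1 / 2) ^ n * seq_of u n"
  by (simp add: weight_def seq_of_diag bounded_weight)

text \<open>The factor \<open>w\<close> multiplies the entries below the diagonal, its inverse those
  above. The case \<open>w = 1\<close> is \<open>L\<close>, and \<open>w = 2\<close> is its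
  conjugate by \<open>weight\<close>, still bounded because a geometric weight changes the
  off-diagonals only by constant factors.\<close>

definition ladder_square :: "complex \<Rightarrow> l2 \<Rightarrow> l2" where
  "ladder_square w u = ladder w (ladder_adj (1 / w) u)"

lemma bounded_linear_ladder_square: "bounded_linear (ladder_square w)"
  unfolding ladder_square_def
  by (rule bounded_linear_compose[OF bounded_linear_ladder bounded_linear_ladder_adj])

lemma ladder_cscale: "ladder w (cscale a u) = cscale a (ladder w u)"
  by (rule l2_eqI, case_tac n) (simp_all add: algebra_simps)

lemma ladder_adj_cscale: "ladder_adj w (cscale a u) = cscale a (ladder_adj w u)"
  by (rule l2_eqI) (simp add: algebra_simps)

lemma ladder_square_cscale: "ladder_square w (cscale a u) = cscale a (ladder_square w u)"
  by (simp add: ladder_square_def ladder_cscale ladder_adj_cscale)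

text \<open>Moving one factor over gives the inner product of \<open>ladder_adj 1 u\<close> and
  \<open>ladder_adj 1 v\<close>, which is Hermitian in \<open>u\<close> and
  \<open>v\<close>.\<close>

lemma seq_inner_ladder_square:
  "seq_inner (seq_of (ladder_square 1 u)) (seq_of v) = seq_inner (seq_of u) (seq_of (ladder_square 1 v))"
proof -
  have "seq_inner (seq_of (ladder_square 1 u)) (seq_of v) =
      seq_inner (seq_of (ladder_adj 1 u)) (seq_of (ladder_adj 1 v))" for u v
    by (simp add: ladder_square_def seq_inner_ladder)
  then show ?thesis
    using seq_inner_commute[of "seq_of (ladder_square 1 v)" "seq_of u"]
      seq_inner_commute[of "seq_of (ladder_adj 1 v)" "seq_of (ladder_adj 1 u)"]
    by (metis seq_inner_commute seq_of_square_summable)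
qed

lemma ladder_weight: "ladder 1 (weight u) = weight (ladder 2 u)"
  by (rule l2_eqI, case_tac n) (simp_all add: algebra_simps)

lemma ladder_adj_weight: "ladder_adj 1 (weight u) = weight (ladder_adj (1 / 2) u)"
  by (rule l2_eqI) (simp add: algebra_simps)

lemma ladder_square_weight: "ladder_square 1 (weight u) = weight (ladder_square 2 u)"
  by (simp add: ladder_square_def ladder_weight ladder_adj_weight)

lemma weight_cscale: "weight (cscale a u) = cscale a (weight u)"
  by (rule l2_eqI) simp

text \<open>\<open>weight\<close> carries \<open>l2\<close> isometrically onto the Sobolev space of
  order 1, so the group of \<open>L\<close> acts there like the exponential of \<open>\<i>\<close>
  times the bounded operator \<open>ladder_square 2\<close>. The latter is not symmetric, hence a
  growing bound in place of an isometry.\<close>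

lemma op_exp_weight:
  "weight (op_exp (i_times (ladder_square 2)) t u) = op_exp (i_times (ladder_square 1)) t (weight u)"
  by (rule op_exp_intertwine[OF _ bounded_linear_weight])
    (simp add: blinop_apply_i_times bounded_linear_ladder_square weight_cscale ladder_square_weight)

section \<open>Eigenvectors of the two products of the ladder operators\<close>

lemma coeff_squares:
  "coeff_a n * coeff_a n + coeff_b n * coeff_b n = 2" "coeff_b n * coeff_a (Suc n) = 1"
proof -
  \<comment> \<open>\<open>n + 2\<close> is the mean of \<open>n + 1\<close> and
    \<open>n + 3\<close>.\<close>
  have "sqrt ((real n + 1) / (real n + 2)) * sqrt ((real n + 1) / (real n + 2)) +
      sqrt ((real n + 3) / (real n + 2)) * sqrt ((real n + 3) / (real n + 2)) = 2"
    by (simp add: add_divide_distrib[symmetric] divide_simps)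
  then show "coeff_a n * coeff_a n + coeff_b n * coeff_b n = 2"
    unfolding coeff_a_def coeff_b_def of_real_mult[symmetric] of_real_add[symmetric]
    by (simp only: of_real_numeral)
  have "sqrt ((real n + 3) / (real n + 2)) * sqrt ((real (Suc n) + 1) / (real (Suc n) + 2)) =
      sqrt (((real n + 3) / (real n + 2)) * ((real n + 2) / (real n + 3)))"
    by (simp only: real_sqrt_mult[symmetric] of_nat_Suc) (simp add: add_ac)
  also have "\<dots> = 1"
    by simp
  finally show "coeff_b n * coeff_a (Suc n) = 1"
    unfolding coeff_a_def coeff_b_def of_real_mult[symmetric] by (simp only: of_real_1)
qed

text \<open>By \<open>coeff_squares\<close> every diagonal entry is 2 and every neighbouring entry
  is -1. Row 0 follows the general pattern with a zero in front of the sequence, a Dirichlet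
  condition.\<close>

lemma ladder_adj_ladder:
  "seq_of (ladder_adj 1 (ladder 1 u)) 0 = 2 * seq_of u 0 - seq_of u 1"
  "seq_of (ladder_adj 1 (ladder 1 u)) (Suc n) =
    2 * seq_of u (Suc n) - seq_of u n - seq_of u (Suc (Suc n))"
proof -
  have "seq_of (ladder_adj 1 (ladder 1 u)) 0 =
      (coeff_a 0 * coeff_a 0 + coeff_b 0 * coeff_b 0) * seq_of u 0 -
      coeff_b 0 * coeff_a (Suc 0) * seq_of u 1"
    by (simp add: algebra_simps)
  then show "seq_of (ladder_adj 1 (ladder 1 u)) 0 = 2 * seq_of u 0 - seq_of u 1"
    by (simp only: coeff_squares mult_1)
  have "seq_of (ladder_adj 1 (ladder 1 u)) (Suc n) =
      (coeff_a (Suc n) * coeff_a (Suc n) + coeff_b (Suc n) * coeff_b (Suc n)) * seq_of u (Suc n) -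
      coeff_b n * coeff_a (Suc n) * seq_of u n -
      coeff_b (Suc n) * coeff_a (Suc (Suc n)) * seq_of u (Suc (Suc n))"
    by (simp add: algebra_simps)
  then show "seq_of (ladder_adj 1 (ladder 1 u)) (Suc n) =
      2 * seq_of u (Suc n) - seq_of u n - seq_of u (Suc (Suc n))"
    by (simp only: coeff_squares mult_1)
qed

lemma seq_of_tendsto_0: "seq_of u \<longlonglongrightarrow> 0"
proof -
  have "(\<lambda>n. sqrt ((cmod (seq_of u n))\<^sup>2)) \<longlonglongrightarrow> sqrt 0"
    by (rule tendsto_real_sqrt[OF summable_LIMSEQ_zero[OF summable_norm_seq_of]])
  then show ?thesis
    by (simp add: tendsto_norm_zero_iff)
qed

lemma free_no_eigenvector:
  assumes "ladder_adj 1 (ladder 1 u) = cscale \<mu> u"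
  shows "u = 0"
proof -
  define \<kappa> where "\<kappa> = 2 - \<mu>"
  have rec0: "seq_of u 1 = \<kappa> * seq_of u 0"
    using ladder_adj_ladder(1)[of u] by (simp add: assms \<kappa>_def algebra_simps)
  have rec: "seq_of u (Suc (Suc n)) = \<kappa> * seq_of u (Suc n) - seq_of u n" for n
    using ladder_adj_ladder(2)[of u n] by (simp add: assms \<kappa>_def algebra_simps)
  \<comment> \<open>Plain squares instead of moduli make this an algebraic identity, valid for
    complex \<open>\<kappa>\<close>, as \<open>\<mu>\<close> is an arbitrary complex number.\<close>
  have inv: "(seq_of u n)\<^sup>2 - \<kappa> * seq_of u n * seq_of u (Suc n) + (seq_of u (Suc n))\<^sup>2 = (seq_of u 0)\<^sup>2" for n
  proof (induction n)
    case 0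
    show ?case using rec0 by (simp add: power2_eq_square algebra_simps)
  next
    case (Suc n)
    then show ?case by (simp add: rec power2_eq_square algebra_simps)
  qed
  \<comment> \<open>The entries tend to 0, so the constant value of the invariant is 0.\<close>
  have "(\<lambda>n. (seq_of u n)\<^sup>2 - \<kappa> * seq_of u n * seq_of u (Suc n) + (seq_of u (Suc n))\<^sup>2) \<longlonglongrightarrow>
      0\<^sup>2 - \<kappa> * 0 * 0 + 0\<^sup>2"
    by (intro tendsto_intros seq_of_tendsto_0 LIMSEQ_Suc[OF seq_of_tendsto_0])
  then have "seq_of u 0 = 0"
    unfolding inv by (simp add: LIMSEQ_const_iff)
  \<comment> \<open>Two adjacent zeros propagate through the recursion.\<close>
  then have "seq_of u n = 0 \<and> seq_of u (Suc n) = 0" for n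
    by (induction n) (simp_all add: rec rec0[simplified])
  then show ?thesis
    by (intro l2_eqI) simp
qed

text \<open>Applying \<open>ladder_adj 1\<close> to both sides shows that
  \<open>ladder_adj 1 u\<close> solves the eigenvalue equation of the free Laplacian, whose only
  solution is 0. This includes \<open>\<mu> = 0\<close>.\<close>

lemma ladder_square_eigenvector:
  assumes "ladder_square 1 u = cscale \<mu> u"
  shows "ladder_adj 1 u = 0"
proof (rule free_no_eigenvector)
  show "ladder_adj 1 (ladder 1 (ladder_adj 1 u)) = cscale \<mu> (ladder_adj 1 u)"
    using assms by (simp add: ladder_square_def ladder_adj_cscale[symmetric])
qed

text \<open>Each step multiplies the squared modulus by \<open>(n + 1) / (n + 3)\<close>, and the
  product telescopes; the factor 2 fits \<open>n = 0\<close>.\<close>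

lemma ladder_adj_kernel:
  assumes "ladder_adj 1 u = 0"
  shows "(cmod (seq_of u n))\<^sup>2 = 2 * (cmod (seq_of u 0))\<^sup>2 / ((real n + 1) * (real n + 2))"
proof (induction n)
  case (Suc n)
  have "coeff_b n * seq_of u (Suc n) = coeff_a n * seq_of u n"
    using seq_of_ladder_adj[of 1 u n] by (simp add: assms)
  then have "(cmod (coeff_b n * seq_of u (Suc n)))\<^sup>2 = (cmod (coeff_a n * seq_of u n))\<^sup>2"
    by simp
  then have "(real n + 3) / (real n + 2) * (cmod (seq_of u (Suc n)))\<^sup>2 =
      (real n + 1) / (real n + 2) * (cmod (seq_of u n))\<^sup>2"
    by (simp add: norm_mult power_mult_distrib coeff_a_def coeff_b_def)
  then have "(cmod (seq_of u (Suc n)))\<^sup>2 = (real n + 1) / (real n + 3) * (cmod (seq_of u n))\<^sup>2"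
    by (simp add: field_simps)
  also have "\<dots> = 2 * (cmod (seq_of u 0))\<^sup>2 / ((real n + 2) * (real n + 3))"
    unfolding Suc by (simp add: divide_simps)
  finally show ?case
    by (simp add: add_ac)
qed simp

lemma ladder_adj_kernel_exists: "\<exists>u. u \<noteq> 0 \<and> ladder_adj 1 u = 0"
proof -
  \<comment> \<open>The positive solution of the kernel recursion with
    \<open>x 0 = 1 / sqrt 2\<close>, for which the numerator in \<open>ladder_adj_kernel\<close> is
    1.\<close>
  define x where "x n = complex_of_real (1 / sqrt ((real n + 1) * (real n + 2)))" for n
  have sq: "(cmod (x n))\<^sup>2 = 1 / ((real n + 1) * (real n + 2))" for n
    unfolding x_def norm_of_real by (simp add: power_divide)
  have "summable (\<lambda>n. inverse ((real (Suc n))\<^sup>2))"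
    using inverse_power_summable[of 2, where 'a = real] summable_Suc_iff[of "\<lambda>n. inverse ((real n)\<^sup>2)"] by simp
  moreover have "norm ((cmod (x n))\<^sup>2) \<le> inverse ((real (Suc n))\<^sup>2)" for n
  proof -
    have "1 / ((real n + 1) * (real n + 2)) \<le> 1 / ((real n + 1) * (real n + 1))"
      by (intro divide_left_mono mult_left_mono) auto
    then show ?thesis
      by (simp add: sq) (simp add: power2_eq_square inverse_eq_divide add_ac)
  qed
  ultimately have x: "x \<in> square_summable"
    unfolding square_summable_def mem_Collect_eq
    by (rule summable_comparison_test'[where N = 0])
  \<comment> \<open>Both sides equal \<open>1 / (n + 2)\<close>.\<close>
  have "coeff_a n * x n = coeff_b n * x (Suc n)" for n
  proof -
    have "sqrt ((real n + 1) / (real n + 2)) * (1 / sqrt ((real n + 1) * (real n + 2))) =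
        1 / (real n + 2)"
      by (simp add: real_sqrt_divide real_sqrt_mult divide_simps)
    moreover have "sqrt ((real n + 3) / (real n + 2)) * (1 / sqrt ((real (Suc n) + 1) * (real (Suc n) + 2))) =
        1 / (real n + 2)"
      by (simp add: real_sqrt_divide real_sqrt_mult divide_simps add_ac)
    ultimately show ?thesis
      unfolding x_def coeff_a_def coeff_b_def of_real_mult[symmetric] by simp
  qed
  then have "ladder_adj 1 (Abs_l2 x) = 0"
    by (intro l2_eqI) (simp add: Abs_l2_inverse x)
  moreover have "seq_of (Abs_l2 x) 0 \<noteq> 0"
    by (simp add: Abs_l2_inverse x) (simp add: x_def)
  then have "Abs_l2 x \<noteq> 0" by auto
  ultimately show ?thesis by blast
qed

section \<open>The Sobolev spaces of the powers of 4 and the decay of eigenvectors\<close>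

abbreviation eigenvalue :: "nat \<Rightarrow> real" where
  "eigenvalue n \<equiv> 4 ^ n"

abbreviation basis_vector :: "nat \<Rightarrow> nat \<Rightarrow> complex" where
  "basis_vector n \<equiv> seq_of (single n 1)"

lemma sobolev_1_weight:
  "eigenvalue n powr 1 * (cmod (seq_inner (seq_of (weight u)) (basis_vector n)))\<^sup>2 = (cmod (seq_of u n))\<^sup>2"
proof -
  \<comment> \<open>The ratio \<open>1 / 2\<close> of \<open>weight\<close> is the inverse square
    root of the ratio 4 of the eigenvalues.\<close>
  have "(4 :: real) ^ n * ((1 / 2) ^ n)\<^sup>2 = 1"
    by (simp add: power_mult[symmetric] power2_eq_square power_mult_distrib[symmetric])
  then show ?thesis
    by (simp add: norm_mult norm_power norm_divide power_mult_distrib)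
qed

lemma sobolev_space_1: "sobolev_space l2_space eigenvalue basis_vector 1 = seq_of ` range weight"
proof (intro equalityI subsetI)
  fix x
  assume "x \<in> sobolev_space l2_space eigenvalue basis_vector 1"
  then have x: "x \<in> square_summable" "summable (\<lambda>n. 4 ^ n * (cmod (x n))\<^sup>2)"
    by (simp_all add: sobolev_space_def)
  have "4 ^ n * (cmod (x n))\<^sup>2 = (cmod (2 ^ n * x n))\<^sup>2" for n
  proof -
    have "(4 :: real) ^ n = (2 ^ n)\<^sup>2"
      by (simp add: power2_eq_square power_mult_distrib[symmetric])
    then show ?thesis
      by (simp add: norm_mult norm_power power_mult_distrib)
  qed
  \<comment> \<open>The condition of order 1 says exactly that the preimage under
    \<open>weight\<close> is square-summable.\<close>
  with x(2) have y: "(\<lambda>n. 2 ^ n * x n) \<in> square_summable"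
    by (simp add: square_summable_def)
  have "x = seq_of (weight (Abs_l2 (\<lambda>n. 2 ^ n * x n)))"
    by (auto simp: fun_eq_iff Abs_l2_inverse[OF y] power_divide)
  then show "x \<in> seq_of ` range weight"
    by blast
next
  fix x
  assume "x \<in> seq_of ` range weight"
  then show "x \<in> sobolev_space l2_space eigenvalue basis_vector 1"
    unfolding sobolev_space_def
    by (auto simp only: l2_space_simps sobolev_1_weight summable_norm_seq_of seq_of_square_summable)
qed

lemma sobolev_norm_1: "sobolev_norm l2_space eigenvalue basis_vector 1 (seq_of (weight u)) = norm u"
  unfolding sobolev_norm_def l2_space_simps sobolev_1_weight by (simp add: norm_l2_eq)

text \<open>The squared moduli decay only like \<open>1 / n^2\<close>, while any positive power of
  \<open>4 ^ n\<close> grows geometrically, so the terms of the Sobolev series do not even tend to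
  0.\<close>

lemma eigenvector_not_sobolev:
  assumes "ladder_adj 1 u = 0" "u \<noteq> 0" "s > 0"
  shows "seq_of u \<notin> sobolev_space l2_space eigenvalue basis_vector s"
proof
  assume "seq_of u \<in> sobolev_space l2_space eigenvalue basis_vector s"
  then have "summable (\<lambda>n. eigenvalue n powr s * (cmod (seq_of u n))\<^sup>2)"
    by (simp add: sobolev_space_def)
  then have lim: "(\<lambda>n. eigenvalue n powr s * (2 * (cmod (seq_of u 0))\<^sup>2 / ((real n + 1) * (real n + 2))))
      \<longlonglongrightarrow> 0"
    unfolding ladder_adj_kernel[OF assms(1), symmetric] by (rule summable_LIMSEQ_zero)
  \<comment> \<open>By the kernel formula, if entry 0 vanished, all entries would.\<close>
  have "(cmod (seq_of u 0))\<^sup>2 \<noteq> 0"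
  proof
    assume "(cmod (seq_of u 0))\<^sup>2 = 0"
    then have "seq_of u n = 0" for n
      using ladder_adj_kernel[OF assms(1), of n] by simp
    then show False
      using assms(2) l2_eqI[of u 0] by simp
  qed
  then have "0 < 2 * (cmod (seq_of u 0))\<^sup>2"
    by simp
  then obtain c where c: "c = 2 * (cmod (seq_of u 0))\<^sup>2" "0 < c"
    by blast
  have "filterlim (\<lambda>n. eigenvalue n powr s * (c / ((real n + 1) * (real n + 2)))) at_top sequentially"
    using \<open>0 < c\<close> \<open>s > 0\<close> by real_asymp
  then show False
    using lim unfolding c(1)[symmetric]
    by (meson filterlim_at_top_imp_at_infinity not_tendsto_and_filterlim_at_infinity sequentially_bot)
qed

theorem theorem4p1:
  shows "\<exists>(H :: (nat \<Rightarrow> complex) cinner_space)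
           (\<Gamma> :: (nat \<Rightarrow> complex) operator) (lam :: nat \<Rightarrow> real) (e :: nat \<Rightarrow> nat \<Rightarrow> complex)
           (L :: (nat \<Rightarrow> complex) operator)
           (U :: real \<Rightarrow> (nat \<Rightarrow> complex) \<Rightarrow> (nat \<Rightarrow> complex)).
    separable_hilbert_space H \<and>
    self_adjoint H \<Gamma> \<and> positive_operator H \<Gamma> \<and> unbounded_operator H \<Gamma> \<and>
    discrete_spectrum H \<Gamma> lam e \<and>
    self_adjoint H L \<and> unitary_group_generated_by H L U \<and>
    (\<exists>(C :: real) (B :: real \<Rightarrow> real).
      (\<forall>T \<ge> 0. B absolutely_integrable_on {0..T}) \<and>
      (\<forall>\<phi> \<in> sobolev_space H lam e 1.
        \<phi> \<in> op_dom L \<and>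
        hnorm H (op_app L \<phi>) \<le> C * sobolev_norm H lam e 1 \<phi> \<and>
        (\<forall>t > 0. U t \<phi> \<in> sobolev_space H lam e 1 \<and>
          sobolev_norm H lam e 1 (U t \<phi>) \<le> B t * sobolev_norm H lam e 1 \<phi>))) \<and>
    eigenvectors H L \<noteq> {} \<and>
    (\<forall>v \<in> eigenvectors H L. \<forall>s > 0. v \<notin> sobolev_space H lam e s)"
proof -
  let ?L = "ladder_square 1"
  have L: "bounded_linear ?L" "\<And>a u. ?L (cscale a u) = cscale a (?L u)"
    "\<And>u v. seq_inner (seq_of (?L u)) (seq_of v) = seq_inner (seq_of u) (seq_of (?L v))"
    by (rule bounded_linear_ladder_square ladder_square_cscale seq_inner_ladder_square)+
  have top: "filterlim eigenvalue at_top sequentially"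
    by real_asymp
  have inc: "incseq eigenvalue"
    by (auto intro!: incseq_SucI)
  \<comment> \<open>The Sobolev norm of order 1 of \<open>weight u\<close> is the norm of
    \<open>u\<close>, so \<open>C\<close> is an operator bound for \<open>?L\<close> after
    \<open>weight\<close>.\<close>
  obtain C where C: "\<And>u. norm (?L (weight u)) \<le> norm u * C"
    using bounded_linear.bounded[OF bounded_linear_compose[OF L(1) bounded_linear_weight]] by blast
  \<comment> \<open>The growth bound \<open>norm_op_exp\<close> of the conjugated group; continuity
    in \<open>t\<close> gives local integrability.\<close>
  define B where "B t = exp (\<bar>t\<bar> * norm (i_times (ladder_square 2)))" for t
  have "B absolutely_integrable_on {0..T}" for T
    unfolding B_def by (intro absolutely_integrable_continuous_real continuous_intros)
  moreover have "hnorm l2_space (op_app (bounded_operator ?L) x) \<le>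
      C * sobolev_norm l2_space eigenvalue basis_vector 1 x"
    "group_of ?L t x \<in> sobolev_space l2_space eigenvalue basis_vector 1"
    "sobolev_norm l2_space eigenvalue basis_vector 1 (group_of ?L t x) \<le>
      B t * sobolev_norm l2_space eigenvalue basis_vector 1 x"
    if x_in: "x \<in> sobolev_space l2_space eigenvalue basis_vector 1" for x t
  proof -
    obtain u where x: "x = seq_of (weight u)"
      using x_in by (auto simp: sobolev_space_1)
    have U: "group_of ?L t x = seq_of (weight (op_exp (i_times (ladder_square 2)) t u))"
      by (simp add: group_of_def x seq_of_inverse op_exp_weight)
    show "hnorm l2_space (op_app (bounded_operator ?L) x) \<le>
        C * sobolev_norm l2_space eigenvalue basis_vector 1 x"
      using C[of u] by (simp only: bounded_operator_simps x seq_of_inverse sobolev_norm_1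
          hnorm_l2_space mult.commute)
    show "group_of ?L t x \<in> sobolev_space l2_space eigenvalue basis_vector 1"
      by (simp add: sobolev_space_1 U)
    show "sobolev_norm l2_space eigenvalue basis_vector 1 (group_of ?L t x) \<le>
        B t * sobolev_norm l2_space eigenvalue basis_vector 1 x"
      unfolding U unfolding x sobolev_norm_1 B_def by (rule norm_op_exp)
  qed
  moreover have "x \<in> op_dom (bounded_operator ?L)"
    if "x \<in> sobolev_space l2_space eigenvalue basis_vector 1" for x
    using that by (simp add: sobolev_space_def)
  moreover have "eigenvectors l2_space (bounded_operator ?L) \<noteq> {}"
  proof -
    obtain u where u: "u \<noteq> 0" "ladder_adj 1 u = 0"
      using ladder_adj_kernel_exists by blast
    \<comment> \<open>A kernel vector of \<open>ladder_adj 1\<close> is an eigenvector of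
      \<open>?L\<close> with eigenvalue 0.\<close>
    have "?L u = 0"
      using u(2) linear_0[OF bounded_linear.linear[OF bounded_linear_ladder]]
      by (simp add: ladder_square_def)
    moreover have "seq_of u \<noteq> (\<lambda>n. 0)"
      using u(1) seq_of_inject[of u 0] by (simp add: zero_l2.rep_eq)
    ultimately have "seq_of u \<in> eigenvectors l2_space (bounded_operator ?L)"
      by (auto simp: eigenvectors_def seq_of_inverse zero_l2.rep_eq intro!: exI[of _ 0])
    then show ?thesis by blast
  qed
  moreover have "x \<notin> sobolev_space l2_space eigenvalue basis_vector s"
    if eig: "x \<in> eigenvectors l2_space (bounded_operator ?L)" and s: "s > 0" for x s
  proof -
    obtain \<mu> where x: "x \<in> square_summable" "x \<noteq> (\<lambda>n. 0)" "seq_of (?L (Abs_l2 x)) = (\<lambda>n. \<mu> * x n)"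
      using eig by (auto simp: eigenvectors_def)
    then obtain u where u: "x = seq_of u"
      using square_summable_obtain by blast
    have "?L u = cscale \<mu> u"
      using x(3) by (simp add: u seq_of_inverse scale_seq_of seq_of_inject)
    then have "ladder_adj 1 u = 0"
      by (rule ladder_square_eigenvector)
    moreover have "u \<noteq> 0"
      using x(2) by (auto simp: u zero_l2.rep_eq)
    ultimately show ?thesis
      unfolding u using s by (rule eigenvector_not_sobolev)
  qed
  ultimately show ?thesis
    using separable_hilbert_space_l2_space self_adjoint_multiplication_operator[of eigenvalue]
      positive_multiplication_operator[of eigenvalue] unbounded_multiplication_operator[OF top]
      discrete_spectrum_multiplication_operator[of eigenvalue, OF _ inc top]
      self_adjoint_bounded_operator[OF L] group_of_generated_by[OF L]
    by (intro exI[of _ l2_space] exI[of _ "multiplication_operator eigenvalue"]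
        exI[of _ eigenvalue] exI[of _ "bounded_operator ?L"] exI[of _ "group_of ?L"]
        exI[of _ basis_vector] conjI exI[of _ C] exI[of _ B]) simp_all
qed

end
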